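(* Let $T$ be a tree with $\Delta(T)\ge \frac{\alpha(T)+2}{2}$. Then $cfc(T)=\Delta(T)$.
   Context: All graphs are simple, finite and undirected. $\Delta(T)$ denotes the maximum degree of $T$, and $\alpha(T)$ its independence number, i.e. the maximum cardinality of a set of pairwise non-adjacent vertices. An edge-coloring of a graph is an arbitrary assignment of colors to its edges (not necessarily proper). An edge-colored graph $G$ is conflict-free connected if any two distinct vertices are connected by a path that contains at least one color used on exactly one of the edges of the path. The conflict-free connection number $cfc(G)$ of a connected graph $G$ is the minimum number of colors in an edge-coloring that makes $G$ conflict-free connected. *)

theory Defs
  imports Complex_Main "Graph_Theory.Graph_Theory"
begin

text \<open>
  A finite simple undirected graph is a \<^locale>\<open>pair_graph\<close>: a finite vertex set with a
  symmetric irreflexive set of arcs. An undirected edge is a pair of opposite arcs, identified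
  with its set of two endpoints.
\<close>

definition ends :: "'a \<times> 'a \<Rightarrow> 'a set" where
  "ends e = {fst e, snd e}"

definition edges :: "'a pair_pre_digraph \<Rightarrow> 'a set set" where
  "edges G = ends ` parcs G"

text \<open>
  The library's acyclicity counts \<open>u, v, u\<close> as a cycle, so in a symmetric digraph
  the cycles of the underlying graph are those of length at least 3.
\<close>

definition undirected_tree :: "'a pair_pre_digraph \<Rightarrow> bool" where
  "undirected_tree G \<longleftrightarrow> pair_graph G \<and> Digraph_Component.connected (with_proj G) \<and>
     \<not> (\<exists>p. pre_digraph.cycle (with_proj G) p \<and> length p \<ge> 3)"

text \<open>Every edge contributes exactly one arc leaving each of its endpoints.\<close>

definition max_degree :: "'a pair_pre_digraph \<Rightarrow> nat" where
  "max_degree G = Max (out_degree (with_proj G) ` pverts G)"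

definition independent_set :: "'a pair_pre_digraph \<Rightarrow> 'a set \<Rightarrow> bool" where
  "independent_set G S \<longleftrightarrow> S \<subseteq> pverts G \<and> pairwise (\<lambda>u v. (u, v) \<notin> parcs G) S"

definition independence_number :: "'a pair_pre_digraph \<Rightarrow> nat" where
  "independence_number G = Max (card ` {S. independent_set G S})"

definition conflict_free_path :: "('a set \<Rightarrow> nat) \<Rightarrow> ('a \<times> 'a) awalk \<Rightarrow> bool" where
  "conflict_free_path c p \<longleftrightarrow> (\<exists>k. \<exists>!e. e \<in> ends ` set p \<and> c e = k)"

definition conflict_free_connected :: "'a pair_pre_digraph \<Rightarrow> ('a set \<Rightarrow> nat) \<Rightarrow> bool" where
  "conflict_free_connected G c \<longleftrightarrow>
     (\<forall>u \<in> pverts G. \<forall>v \<in> pverts G. u \<noteq> v \<longrightarrow>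
        (\<exists>p. pre_digraph.apath (with_proj G) u p v \<and> conflict_free_path c p))"

text \<open>
  Only the values of a coloring on the edges matter. Since the edge set is finite, colors in
  \<^typ>\<open>nat\<close> lose no generality. For a connected graph the minimum exists, as a coloring that is
  injective on the edges qualifies.
\<close>

definition cfc :: "'a pair_pre_digraph \<Rightarrow> nat" where
  "cfc G = (LEAST k. \<exists>c. conflict_free_connected G c \<and> card (c ` edges G) = k)"

end

theory Submission
  imports Defs
begin

text \<open>
  The edges at a vertex of maximum degree need distinct colors, because two neighbours of a vertex
  are joined by a single path. Conversely let \<open>v\<close> have degree \<open>k\<close> in a tree with independence
  number at most \<open>2 * k - 2\<close>; induction on \<open>k\<close> gives a coloring with \<open>k\<close> colors. Suppose that the
  branch \<open>B\<close> at some neighbour \<open>n\<close> of \<open>v\<close> has two non-adjacent vertices other than \<open>n\<close>, and cut the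
  edge \<open>vn\<close>. The part that contains \<open>v\<close> loses 2 in independence number and 1 in the degree of \<open>v\<close>,
  so it has a coloring with \<open>k - 1\<close> colors; \<open>B\<close> has independence number at most \<open>k - 1\<close> (add the
  other neighbours of \<open>v\<close>), and every tree can be colored with as many colors as its independence
  number. The edge \<open>vn\<close> gets a new color, which occurs once on every path through it. If there
  is no such neighbour, then the tree is a spider with centre \<open>v\<close> and legs of length at most 3, and
  the edge at depth \<open>t\<close> of leg \<open>i\<close> gets color \<open>(i + t) mod k\<close>.
\<close>

section \<open>Forests, cuts and colorings\<close>

text \<open>Acyclicity is expressed as "every edge is a bridge", so that deleting an edge can be
  handled by reachability alone. \<open>E\<close> carries no vertex set; subtrees are given by sets
  \<open>A\<close>, and passing to a smaller tree changes only \<open>A\<close>.\<close>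

locale forest_relation =
  fixes E :: "('a \<times> 'a) set"
  assumes E_sym: "(x, y) \<in> E \<Longrightarrow> (y, x) \<in> E"
    and bridge: "(u, w) \<in> E \<Longrightarrow> (u, w) \<notin> (E - {(u, w), (w, u)})\<^sup>*"
begin

lemma E_irrefl: "(x, x) \<notin> E"
  using bridge by blast

text \<open>The sides \<open>ab\<close> and \<open>bc\<close> would be a detour around the bridge
  \<open>ac\<close>.\<close>

lemma no_triangle:
  assumes "(a, b) \<in> E" "(b, c) \<in> E"
  shows "(a, c) \<notin> E"
proof
  assume ac: "(a, c) \<in> E"
  have "(a, b) \<in> E - {(a, c), (c, a)}" "(b, c) \<in> E - {(a, c), (c, a)}"
    using assms ac E_irrefl by auto
  then have "(a, c) \<in> (E - {(a, c), (c, a)})\<^sup>*"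
    by (meson r_into_rtrancl rtrancl_trans)
  then show False
    using bridge[OF ac] by contradiction
qed

section \<open>Connected vertex sets\<close>

definition connected_on :: "'a set \<Rightarrow> bool" where
  "connected_on A \<longleftrightarrow> (\<forall>x\<in>A. \<forall>y\<in>A. (x, y) \<in> (Restr E A)\<^sup>*)"

text \<open>Induction along a walk inside \<open>A\<close>. It serves as the induction rule for
  connected sets, with \<open>S\<close> an explicit description of what can be reached.\<close>

lemma connected_on_closed:
  assumes "connected_on A" "x \<in> A" "x \<in> S" "y \<in> A"
    and closed: "\<And>a b. a \<in> A \<Longrightarrow> a \<in> S \<Longrightarrow> b \<in> A \<Longrightarrow> (a, b) \<in> E \<Longrightarrow> b \<in> S"
  shows "y \<in> S"
proof -
  have "(x, y) \<in> (Restr E A)\<^sup>*"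
    using assms(1,2,4) unfolding connected_on_def by blast
  then show ?thesis
  proof induction
    case base
    show ?case
      using \<open>x \<in> S\<close> .
  next
    case (step a b)
    then show ?case
      using closed[of a b] by blast
  qed
qed

lemma connected_on_edge:
  assumes "connected_on X" "x \<in> X" "x \<in> S" "y \<in> X" "y \<notin> S"
  obtains a b where "a \<in> X" "a \<in> S" "b \<in> X" "b \<notin> S" "(a, b) \<in> E"
  using connected_on_closed[OF assms(1-4)] assms(5) by blast

text \<open>A walk in \<open>R\<close> from \<open>u\<close> visits only vertices reachable from
  \<open>u\<close>, so it stays in the component; by symmetry any two vertices are joined through
  \<open>u\<close>.\<close>

lemma connected_on_component:
  assumes "sym R" "R \<subseteq> Restr E A"
  shows "connected_on {x \<in> A. (u, x) \<in> R\<^sup>*}"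
proof -
  let ?B = "{x \<in> A. (u, x) \<in> R\<^sup>*}"
  have *: "(u, x) \<in> (Restr E ?B)\<^sup>*" if "(u, x) \<in> R\<^sup>*" for x
    using that
  proof induction
    case (step y z)
    then have "(u, z) \<in> R\<^sup>*"
      by auto
    with step assms have "(y, z) \<in> Restr E ?B"
      by auto
    with step.IH show ?case
      by (rule rtrancl_into_rtrancl)
  qed auto
  moreover have "sym ((Restr E ?B)\<^sup>*)"
    by (intro sym_rtrancl symI) (auto intro: E_sym)
  ultimately show ?thesis
    unfolding connected_on_def by (blast intro: rtrancl_trans dest: symD)
qed

section \<open>Cutting a tree at an edge\<close>

definition branch :: "'a set \<Rightarrow> 'a \<Rightarrow> 'a \<Rightarrow> 'a set" where
  "branch A u w = {x \<in> A. (u, x) \<in> (Restr E A - {(u, w), (w, u)})\<^sup>*}"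

text \<open>Packages what later arguments use about the two sides of a deleted edge
  \<open>uw\<close>, in a form that is symmetric in the sides.\<close>

definition cut :: "'a set \<Rightarrow> 'a \<Rightarrow> 'a \<Rightarrow> 'a set \<Rightarrow> 'a set \<Rightarrow> bool" where
  "cut A u w B C \<longleftrightarrow> A = B \<union> C \<and> B \<inter> C = {} \<and> u \<in> B \<and> w \<in> C \<and> connected_on B \<and> connected_on C \<and>
     (\<forall>b\<in>B. \<forall>c\<in>C. (b, c) \<in> E \<longrightarrow> b = u \<and> c = w)"

lemma cutD:
  assumes "cut A u w B C"
  shows "A = B \<union> C" "B \<inter> C = {}" "u \<in> B" "w \<in> C" "connected_on B" "connected_on C"
    and "\<And>b c. b \<in> B \<Longrightarrow> c \<in> C \<Longrightarrow> (b, c) \<in> E \<Longrightarrow> b = u \<and> c = w"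
    and "\<And>b c. b \<in> B \<Longrightarrow> c \<in> C \<Longrightarrow> (c, b) \<in> E \<Longrightarrow> b = u \<and> c = w"
  using assms unfolding cut_def by (blast dest: E_sym)+

text \<open>The components of \<open>u\<close> and \<open>w\<close> are disjoint because
  \<open>uw\<close> is a bridge. They exhaust \<open>A\<close> because every other edge stays within
  one component.\<close>

lemma cut_branch:
  assumes A: "connected_on A" "u \<in> A" "w \<in> A" and uw: "(u, w) \<in> E"
  shows "cut A u w (branch A u w) (A - branch A u w)"
proof -
  define R where "R = Restr E A - {(u, w), (w, u)}"
  have symR: "sym R"
    unfolding R_def by (intro symI) (auto intro: E_sym)
  have RE: "R \<subseteq> Restr E A"
    by (auto simp: R_def)
  have "R \<subseteq> E - {(u, w), (w, u)}"
    by (auto simp: R_def)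
  then have not_uw: "(u, w) \<notin> R\<^sup>*"
    using bridge[OF uw] rtrancl_mono by blast
  define B where "B = {x \<in> A. (u, x) \<in> R\<^sup>*}"
  define C where "C = {x \<in> A. (w, x) \<in> R\<^sup>*}"
  have disj: "B \<inter> C = {}"
  proof (rule ccontr)
    assume "B \<inter> C \<noteq> {}"
    then obtain x where "(u, x) \<in> R\<^sup>*" "(w, x) \<in> R\<^sup>*"
      by (auto simp: B_def C_def)
    then show False
      using not_uw symD[OF sym_rtrancl[OF symR]] rtrancl_trans by metis
  qed
  have "x \<in> B \<union> C" if "x \<in> A" for x
  proof (rule connected_on_closed[OF A(1,2) _ that])
    show "u \<in> B \<union> C"
      using A by (auto simp: B_def)
    fix a b
    assume ab: "a \<in> A" "a \<in> B \<union> C" "b \<in> A" "(a, b) \<in> E"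
    show "b \<in> B \<union> C"
    proof (cases "(a, b) \<in> R")
      case True
      then show ?thesis
        using ab by (auto simp: B_def C_def intro: rtrancl_into_rtrancl)
    next
      case False
      then have "b = u \<or> b = w"
        using ab by (auto simp: R_def)
      then show ?thesis
        using A by (auto simp: B_def C_def)
    qed
  qed
  then have C: "A - B = C"
    using disj by (auto simp: B_def C_def)
  have "w \<notin> B"
    using not_uw by (auto simp: B_def)
  have "b = u \<and> c = w" if "b \<in> B" "c \<in> C" "(b, c) \<in> E" for b c
  proof (rule ccontr)
    assume "\<not> ?thesis"
    moreover have "(b, c) \<noteq> (w, u)"
      using \<open>w \<notin> B\<close> that by auto
    ultimately have "(b, c) \<in> R"
      using that by (auto simp: R_def B_def C_def)
    then have "c \<in> B"
      using that by (auto simp: B_def C_def)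
    then show False
      using disj that by auto
  qed
  moreover have "connected_on B" "connected_on C"
    unfolding B_def C_def using connected_on_component[OF symR RE] by auto
  ultimately have "cut A u w B C"
    using A disj C unfolding cut_def by (auto simp: B_def C_def)
  then show ?thesis
    using C by (simp add: branch_def B_def R_def)
qed

section \<open>Independent sets\<close>

definition independent :: "'a set \<Rightarrow> bool" where
  "independent I \<longleftrightarrow> (\<forall>x\<in>I. \<forall>y\<in>I. (x, y) \<notin> E)"

definition alpha_le :: "'a set \<Rightarrow> nat \<Rightarrow> bool" where
  "alpha_le A a \<longleftrightarrow> (\<forall>I\<subseteq>A. independent I \<longrightarrow> card I \<le> a)"

lemma independent_Un:
  assumes "independent I" "independent J" "\<And>x y. x \<in> I \<Longrightarrow> y \<in> J \<Longrightarrow> (x, y) \<notin> E"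
  shows "independent (I \<union> J)"
  using assms unfolding independent_def by (blast dest: E_sym)

text \<open>An edge between two neighbours of \<open>v\<close> would close a triangle.\<close>

lemma independent_neighbours: "independent {n \<in> A. (v, n) \<in> E}"
  unfolding independent_def using no_triangle by blast

section \<open>Paths and colorings in terms of vertex sets\<close>

definition edges_on :: "'a set \<Rightarrow> 'a set set" where
  "edges_on X = {{x, y} |x y. x \<in> X \<and> y \<in> X \<and> (x, y) \<in> E}"

text \<open>
  In a forest a path is an induced subgraph, so it can be represented by its vertex set: a
  connected set with at least one edge and no vertex having three neighbours in it.
\<close>

definition path_set :: "'a set \<Rightarrow> bool" where
  "path_set X \<longleftrightarrow> connected_on X \<and> edges_on X \<noteq> {} \<and>
     \<not> (\<exists>v\<in>X. \<exists>N\<subseteq>X. card N = 3 \<and> (\<forall>n\<in>N. (v, n) \<in> E))"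

definition conflict_free_on :: "'a set \<Rightarrow> ('a set \<Rightarrow> nat) \<Rightarrow> bool" where
  "conflict_free_on X c \<longleftrightarrow> (\<exists>k. \<exists>!e. e \<in> edges_on X \<and> c e = k)"

definition colorable :: "'a set \<Rightarrow> nat \<Rightarrow> bool" where
  "colorable A a \<longleftrightarrow> (\<exists>c. c ` edges_on A \<subseteq> {..<a} \<and>
     (\<forall>X\<subseteq>A. path_set X \<longrightarrow> conflict_free_on X c))"

lemma edges_on_mono: "X \<subseteq> Y \<Longrightarrow> edges_on X \<subseteq> edges_on Y"
  by (auto simp: edges_on_def)

lemma edges_onD: "e \<in> edges_on X \<Longrightarrow> e \<subseteq> X"
  by (auto simp: edges_on_def)

lemma edges_on_nonempty: "e \<in> edges_on X \<Longrightarrow> e \<noteq> {}"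
  by (auto simp: edges_on_def)

lemma edges_onI: "x \<in> X \<Longrightarrow> y \<in> X \<Longrightarrow> (x, y) \<in> E \<Longrightarrow> {x, y} \<in> edges_on X"
  by (auto simp: edges_on_def)

lemma conflict_free_on_cong:
  assumes "\<And>e. e \<in> edges_on X \<Longrightarrow> c e = d e" "conflict_free_on X d"
  shows "conflict_free_on X c"
  using assms unfolding conflict_free_on_def by (metis (no_types, lifting))

lemma cut_swap: "cut A u w B C \<Longrightarrow> cut A w u C B"
  unfolding cut_def by (blast dest: E_sym)

text \<open>Both sides share the same \<open>a\<close> colors, and \<open>uw\<close> gets the fresh
  color \<open>a\<close>. A path that meets both sides contains \<open>uw\<close>, the only edge of
  that color.\<close>

lemma colorable_cut:
  assumes cut: "cut A u w B C" and B: "colorable B a" and C: "colorable C a"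
  shows "colorable A (Suc a)"
proof -
  obtain cB where cB: "cB ` edges_on B \<subseteq> {..<a}" "\<And>X. X \<subseteq> B \<Longrightarrow> path_set X \<Longrightarrow> conflict_free_on X cB"
    using B unfolding colorable_def by auto
  obtain cC where cC: "cC ` edges_on C \<subseteq> {..<a}" "\<And>X. X \<subseteq> C \<Longrightarrow> path_set X \<Longrightarrow> conflict_free_on X cC"
    using C unfolding colorable_def by auto
  \<comment> \<open>The only edge of \<open>A\<close> that lies inside neither side is
    \<open>uw\<close>, so the default value is the fresh color.\<close>
  define c where "c e = (if e \<subseteq> B then cB e else if e \<subseteq> C then cC e else a)" for e
  have disj: "B \<inter> C = {}" and un: "A = B \<union> C"
    using cutD[OF cut] by blast+
  have cB_eq: "c e = cB e" if "e \<in> edges_on B" for e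
    using edges_onD[OF that] by (simp add: c_def)
  have cC_eq: "c e = cC e" if "e \<in> edges_on C" for e
    using edges_onD[OF that] edges_on_nonempty[OF that] disj by (auto simp: c_def)
  have edge_cases: "e \<in> edges_on B \<or> e \<in> edges_on C \<or> e = {u, w}" if e: "e \<in> edges_on A" for e
  proof -
    obtain x y where xy: "e = {x, y}" "x \<in> A" "y \<in> A" "(x, y) \<in> E"
      using e by (auto simp: edges_on_def)
    have cross: "b = u \<and> d = w" if "b \<in> B" "d \<in> C" "(b, d) \<in> E" for b d
      using cutD(7)[OF cut] that by blast
    show ?thesis
    proof (cases "x \<in> B \<longleftrightarrow> y \<in> B")
      case True
      then show ?thesis
        using xy un edges_onI[of x _ y] by auto
    next
      case False
      then show ?thesis
        using xy un cross[of x y] cross[of y x] E_sym[of x y] by auto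
    qed
  qed
  have c_uw: "c {u, w} = a"
    using cutD(3,4)[OF cut] disj by (auto simp: c_def)
  have lt: "c e < a" if e: "e \<in> edges_on A" "e \<noteq> {u, w}" for e
  proof -
    consider "e \<in> edges_on B" | "e \<in> edges_on C"
      using edge_cases[OF e(1)] e(2) by blast
    then show ?thesis
      using cB(1) cC(1) cB_eq cC_eq by cases auto
  qed
  have "conflict_free_on X c" if X: "X \<subseteq> A" "path_set X" for X
  proof -
    consider "X \<subseteq> B" | "X \<subseteq> C" | x y where "x \<in> X" "x \<in> B" "y \<in> X" "y \<in> C"
      using X un by blast
    then show ?thesis
    proof cases
      case 1
      then show ?thesis
        using cB(2)[OF 1 X(2)] cB_eq edges_on_mono[OF 1] conflict_free_on_cong[of X c cB] by blast
    next
      case 2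
      then show ?thesis
        using cC(2)[OF 2 X(2)] cC_eq edges_on_mono[OF 2] conflict_free_on_cong[of X c cC] by blast
    next
      case 3
      have "connected_on X"
        using X by (simp add: path_set_def)
      then obtain p q where pq: "p \<in> X" "p \<in> B" "q \<in> X" "q \<notin> B" "(p, q) \<in> E"
        using connected_on_edge[of X x B y] 3 disj by blast
      then have "p = u" "q = w"
        using cutD(7)[OF cut, of p q] X un by blast+
      then have "{u, w} \<in> edges_on X"
        using pq edges_onI by auto
      moreover have "e = {u, w}" if "e \<in> edges_on X" "c e = a" for e
        using lt[of e] that edges_on_mono[OF X(1)] by auto
      ultimately have "\<exists>!e. e \<in> edges_on X \<and> c e = a"
        using c_uw by (metis (no_types, lifting))
      then show ?thesis
        unfolding conflict_free_on_def ..
    qed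
  qed
  moreover have "c ` edges_on A \<subseteq> {..<Suc a}"
  proof (intro image_subsetI)
    fix e
    assume "e \<in> edges_on A"
    then show "c e \<in> {..<Suc a}"
      using c_uw lt[of e] by (cases "e = {u, w}") auto
  qed
  ultimately show ?thesis
    unfolding colorable_def by blast
qed

section \<open>Colorings with as many colors as the independence number\<close>

lemma colorable_inj:
  assumes "finite (edges_on A)" "card (edges_on A) \<le> a"
  shows "colorable A a"
proof -
  obtain c where c: "c ` edges_on A \<subseteq> {..<a}" "inj_on c (edges_on A)"
    using card_le_inj[of "edges_on A" "{..<a}"] assms by auto
  have "conflict_free_on X c" if X: "X \<subseteq> A" "path_set X" for X
  proof -
    obtain e where e: "e \<in> edges_on X"
      using X by (auto simp: path_set_def)
    have "inj_on c (edges_on X)"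
      using inj_on_subset[OF c(2) edges_on_mono[OF X(1)]] .
    then show ?thesis
      unfolding conflict_free_on_def using e by (metis inj_onD)
  qed
  then show ?thesis
    unfolding colorable_def using c by blast
qed

text \<open>A vertex of \<open>B\<close> other than \<open>u\<close> has no neighbour in
  \<open>C\<close>, so it enlarges every independent subset of \<open>C\<close> by one.\<close>

lemma alpha_le_cut:
  assumes A: "finite A" "alpha_le A (Suc a)" and cut: "cut A u w B C"
    and x: "x \<in> B" "x \<noteq> u"
  shows "alpha_le C a"
  unfolding alpha_le_def
proof (intro allI impI)
  fix I
  assume I: "I \<subseteq> C" "independent I"
  have "independent (I \<union> {x})"
  proof (rule independent_Un[OF I(2)])
    show "independent {x}"
      using E_irrefl by (simp add: independent_def)
    show "(y, z) \<notin> E" if "y \<in> I" "z \<in> {x}" for y z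
      using cutD(8)[OF cut, of x y] x I that by blast
  qed
  moreover have "I \<union> {x} \<subseteq> A"
    using I x cutD(1)[OF cut] by auto
  ultimately have "card (I \<union> {x}) \<le> Suc a"
    using A unfolding alpha_le_def by blast
  moreover have "x \<notin> I" "finite I"
    using I x A cutD(1,2)[OF cut] finite_subset[of I A] by auto
  ultimately show "card I \<le> a"
    by simp
qed

text \<open>The condition on \<open>y\<close> makes \<open>A\<close> a star with centre
  \<open>y\<close>, possibly a single vertex. Its edges correspond to the neighbours of
  \<open>y\<close>, which are independent, so at most \<open>a\<close> distinct colors
  suffice.\<close>

lemma colorable_star:
  assumes A: "finite A" "connected_on A" "y \<in> A"
    and star: "\<And>n t. n \<in> A \<Longrightarrow> t \<in> A \<Longrightarrow> (y, n) \<in> E \<Longrightarrow> (n, t) \<in> E \<Longrightarrow> t = y"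
    and a: "alpha_le A a"
  shows "colorable A a"
proof -
  let ?N = "{n \<in> A. (y, n) \<in> E}"
  have "x \<in> insert y ?N" if "x \<in> A" for x
    by (rule connected_on_closed[OF A(2,3) _ that]) (use star in auto)
  then have A_eq: "A = insert y ?N"
    using A by auto
  have "edges_on A \<subseteq> (\<lambda>n. {y, n}) ` ?N"
  proof
    fix e
    assume "e \<in> edges_on A"
    then obtain p q where pq: "e = {p, q}" "p \<in> A" "q \<in> A" "(p, q) \<in> E"
      by (auto simp: edges_on_def)
    show "e \<in> (\<lambda>n. {y, n}) ` ?N"
    proof (cases "p = y")
      case True
      then show ?thesis using pq by auto
    next
      case False
      then have "(y, p) \<in> E"
        using pq A_eq by blast
      with star[of p q] pq have "q = y"
        by blast
      then show ?thesis
        using pq \<open>(y, p) \<in> E\<close> by auto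
    qed
  qed
  moreover have "card ?N \<le> a"
    using a independent_neighbours[of A y] unfolding alpha_le_def by auto
  moreover have "finite ?N"
    using A by auto
  ultimately show ?thesis
    by (meson card_image_le card_mono colorable_inj finite_imageI finite_subset le_trans)
qed

text \<open>Induction on \<open>a\<close>. Cutting the middle edge of a path on four vertices costs
  one color, and each side loses 1 in independence number. A tree without such a path is a
  star.\<close>

lemma colorable_alpha:
  assumes "finite A" "connected_on A" "alpha_le A a"
  shows "colorable A a"
  using assms
proof (induction a arbitrary: A)
  case 0
  have "A = {}"
  proof (rule ccontr)
    assume "A \<noteq> {}"
    then obtain x where "x \<in> A"
      by blast
    then have "card {x} \<le> 0"
      using 0(3) E_irrefl unfolding alpha_le_def independent_def by blast
    then show False
      by simp
  qed
  then show ?case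
    by (auto simp: colorable_def path_set_def edges_on_def)
next
  case (Suc a)
  show ?case
  proof (cases "\<exists>x\<in>A. \<exists>u\<in>A. \<exists>w\<in>A. \<exists>z\<in>A. (x, u) \<in> E \<and> (u, w) \<in> E \<and> (w, z) \<in> E \<and> x \<noteq> w \<and> z \<noteq> u")
    case True
    then obtain x u w z where p: "x \<in> A" "u \<in> A" "w \<in> A" "z \<in> A" "(x, u) \<in> E" "(u, w) \<in> E" "(w, z) \<in> E"
        "x \<noteq> w" "z \<noteq> u"
      by blast
    obtain B C where cut: "cut A u w B C"
      using cut_branch[of A u w] p Suc by blast
    have "x \<in> B" "z \<in> C"
      using cutD[OF cut] p by blast+
    moreover have "x \<noteq> u" "z \<noteq> w"
      using p E_irrefl by auto
    ultimately have "alpha_le C a" "alpha_le B a"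
      using alpha_le_cut[OF Suc(2,4) cut] alpha_le_cut[OF Suc(2,4) cut_swap[OF cut]] by auto
    moreover have "finite B" "finite C" "connected_on B" "connected_on C"
      using cutD(1,5,6)[OF cut] Suc(2) by auto
    ultimately show ?thesis
      using colorable_cut[OF cut] Suc.IH by blast
  next
    case no_P4: False
    show ?thesis
    proof (cases "\<exists>y\<in>A. \<exists>m\<in>A. \<exists>n\<in>A. m \<noteq> n \<and> (y, m) \<in> E \<and> (y, n) \<in> E")
      case True
      then obtain y m n where y: "y \<in> A" "m \<in> A" "n \<in> A" "m \<noteq> n" "(y, m) \<in> E" "(y, n) \<in> E"
        by blast
      show ?thesis
      proof (rule colorable_star[OF Suc(2,3) y(1) _ Suc(4)])
        fix k t
        assume k: "k \<in> A" "t \<in> A" "(y, k) \<in> E" "(k, t) \<in> E"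
        \<comment> \<open>\<open>l\<close> is a second neighbour of \<open>y\<close>: if
          \<open>t\<close> differed from \<open>y\<close>, then \<open>l, y, k, t\<close> would be
          an excluded path.\<close>
        obtain l where "l \<in> A" "l \<noteq> k" "(l, y) \<in> E"
          using y E_sym[of y m] E_sym[of y n] by metis
        with k y(1) no_P4 show "t = y"
          by blast
      qed
    next
      case False
      show ?thesis
      proof (cases "A = {}")
        case True
        then show ?thesis
          by (auto simp: colorable_def path_set_def edges_on_def)
      next
        case ne: False
        then obtain y where y: "y \<in> A"
          by blast
        \<comment> \<open>No vertex has two neighbours, so any vertex can be the centre of the
          star.\<close>
        show ?thesis
        proof (rule colorable_star[OF Suc(2,3) y _ Suc(4)])
          fix n t
          assume "n \<in> A" "t \<in> A" "(y, n) \<in> E" "(n, t) \<in> E"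
          then show "t = y"
            using False y E_sym[of y n] by blast
        qed
      qed
    qed
  qed
qed

end

section \<open>Cyclic intervals\<close>

lemma nat_add_mod_inj:
  fixes k :: nat
  assumes "s < k" "t < k" "(i + s) mod k = (i + t) mod k"
  shows "s = t"
proof -
  have *: "p = q" if "p \<le> q" "q < k" "(i + p) mod k = (i + q) mod k" for p q
    using that mod_eq_dvd_iff_nat[of "i + p" "i + q" k] by (auto dest: dvd_imp_le)
  show ?thesis
    using *[of s t] *[of t s] assms by (cases "s \<le> t") auto
qed

text \<open>Let \<open>d\<close> be the distance from \<open>i\<close> to \<open>j\<close> modulo
  \<open>k\<close>. If \<open>a \<le> d\<close>, the first residue \<open>j\<close> of the second
  interval misses the first interval. Otherwise the residue \<open>i + a\<close>, just past the end
  of the first, is reached from \<open>j\<close> after \<open>a - d\<close> steps.\<close>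

lemma cyclic_interval_not_subset:
  fixes i j k a b :: nat
  assumes ij: "i < k" "j < k" "i \<noteq> j" and ab: "1 \<le> a" "a \<le> b" "a < k"
  shows "\<exists>t<b. \<forall>s<a. (j + t) mod k \<noteq> (i + s) mod k"
proof -
  define d where "d = (if i < j then j - i else j + k - i)"
  have d: "0 < d" "d < k" and j: "j mod k = (i + d) mod k"
    using ij by (auto simp: d_def)
  show ?thesis
  proof (cases "a \<le> d")
    case True
    have "(j + 0) mod k \<noteq> (i + s) mod k" if "s < a" for s
      using nat_add_mod_inj[of d k s i] that d j True by auto
    then show ?thesis
      using ab by (intro exI[of _ 0]) auto
  next
    case False
    have "(j + (a - d)) mod k = (i + d + (a - d)) mod k"
      using j by (metis mod_add_left_eq)
    also have "\<dots> = (i + a) mod k"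
      using False by simp
    finally have "(j + (a - d)) mod k \<noteq> (i + s) mod k" if "s < a" for s
      using nat_add_mod_inj[of a k s i] that ab by auto
    then show ?thesis
      using False ab d by (intro exI[of _ "a - d"]) auto
  qed
qed

lemma down_closed_nat:
  fixes S :: "nat set"
  assumes "S \<subseteq> {..<m}" "\<And>t. Suc t \<in> S \<Longrightarrow> t \<in> S"
  shows "\<exists>a\<le>m. S = {..<a}"
  using assms
proof (induction m)
  case 0
  then show ?case
    by auto
next
  case (Suc m)
  show ?case
  proof (cases "m \<in> S")
    case True
    have "t \<in> S" if "t \<le> m" for t
      using that True by (induction rule: inc_induct) (auto intro: Suc.prems(2))
    then have "S = {..<Suc m}"
      using Suc.prems(1) by (auto simp: less_Suc_eq_le)
    then show ?thesis
      by blast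
  next
    case False
    then have "S \<subseteq> {..<m}"
      using Suc.prems(1) by (auto simp: less_Suc_eq)
    then show ?thesis
      using Suc.IH Suc.prems(2) by (meson le_Suc_eq)
  qed
qed

text \<open>A pair \<open>(i, t)\<close> stands for the edge at depth \<open>t\<close> of leg
  \<open>i\<close>. The longer leg has a color that the shorter one misses, and no color repeats
  within a leg of length at most \<open>k\<close>.\<close>

lemma unique_cyclic_color_two_legs:
  fixes a b :: nat
  assumes ij: "i < k" "j < k" "i \<noteq> j" and ab: "1 \<le> a" "a \<le> b" "a < k" "b \<le> k"
  shows "\<exists>\<kappa>. \<exists>!z. z \<in> {i} \<times> {..<a} \<union> {j} \<times> {..<b} \<and> (fst z + snd z) mod k = \<kappa>"
proof -
  obtain t where t: "t < b" "\<And>s. s < a \<Longrightarrow> (j + t) mod k \<noteq> (i + s) mod k"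
    using cyclic_interval_not_subset[OF ij ab(1-3)] by blast
  show ?thesis
  proof (intro exI[of _ "(j + t) mod k"] ex1I[of _ "(j, t)"])
    fix z :: "nat \<times> nat"
    assume z: "z \<in> {i} \<times> {..<a} \<union> {j} \<times> {..<b} \<and> (fst z + snd z) mod k = (j + t) mod k"
    then have "fst z = j" "snd z < b"
      using t(2)[of "snd z"] by auto
    then show "z = (j, t)"
      using z t(1) nat_add_mod_inj[of "snd z" k t j] ab by (auto simp: prod_eq_iff)
  qed (use t in auto)
qed

text \<open>\<open>J\<close> models the edges of a path through the centre: initial segments of one
  or two legs. As two legs cannot both have length \<open>k\<close>, the shorter of two segments has
  length below \<open>k\<close>.\<close>

lemma unique_cyclic_color:
  fixes J :: "(nat \<times> nat) set"
  assumes J: "J \<subseteq> (SIGMA i:{..<k}. {..<l i})" "J \<noteq> {}"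
    and down: "\<And>i t. (i, Suc t) \<in> J \<Longrightarrow> (i, t) \<in> J"
    and two: "card (fst ` J) \<le> 2"
    and l: "\<And>i. i < k \<Longrightarrow> l i \<le> k" "\<And>i j. i < k \<Longrightarrow> j < k \<Longrightarrow> i \<noteq> j \<Longrightarrow> l i < k \<or> l j < k"
  shows "\<exists>\<kappa>. \<exists>!z. z \<in> J \<and> (fst z + snd z) mod k = \<kappa>"
proof -
  \<comment> \<open>\<open>a i\<close> counts the edges of leg \<open>i\<close> in \<open>J\<close>,
    which are the ones nearest to the centre.\<close>
  have "\<exists>a\<le>l i. {t. (i, t) \<in> J} = {..<a}" if "i < k" for i
    using J down that by (intro down_closed_nat) auto
  then obtain a where a: "\<And>i. i < k \<Longrightarrow> a i \<le> l i" "\<And>i. i < k \<Longrightarrow> {t. (i, t) \<in> J} = {..<a i}"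
    by metis
  have fst_J: "i < k" "1 \<le> a i" if i: "i \<in> fst ` J" for i
  proof -
    obtain t where t: "(i, t) \<in> J"
      using i by auto
    then show "i < k"
      using J by auto
    with t a(2)[of i] show "1 \<le> a i"
      by (cases "a i") auto
  qed
  have J_eq: "J = (SIGMA i:fst ` J. {..<a i})"
  proof (rule set_eqI)
    fix z :: "nat \<times> nat"
    obtain i t where z: "z = (i, t)"
      by (cases z)
    have "z \<in> J \<longleftrightarrow> i \<in> fst ` J \<and> z \<in> J"
      unfolding z by (metis fst_conv image_eqI)
    also have "\<dots> \<longleftrightarrow> i \<in> fst ` J \<and> t < a i"
      using a(2)[OF fst_J(1), of i] unfolding z by blast
    also have "\<dots> \<longleftrightarrow> z \<in> (SIGMA i:fst ` J. {..<a i})"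
      unfolding z by simp
    finally show "z \<in> J \<longleftrightarrow> z \<in> (SIGMA i:fst ` J. {..<a i})" .
  qed
  have "finite (fst ` J)"
    using fst_J(1) by (meson finite_lessThan finite_subset lessThan_iff subsetI)
  moreover have "fst ` J \<noteq> {}"
    using J by auto
  ultimately have "0 < card (fst ` J)"
    by (simp only: card_gt_0_iff simp_thms)
  then have "card (fst ` J) = 1 \<or> card (fst ` J) = 2"
    using two by linarith
  then consider i where "fst ` J = {i}" | i j where "fst ` J = {i, j}" "i \<noteq> j"
    by (metis card_1_singletonE card_2_iff)
  then show ?thesis
  proof cases
    case 1
    then have i: "i < k" "1 \<le> a i" and Ji: "J = {i} \<times> {..<a i}"
      using fst_J[of i] J_eq by auto
    have "a i \<le> k"
      using a(1)[of i] l(1)[of i] i by simp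
    have "\<exists>!z. z \<in> J \<and> (fst z + snd z) mod k = (i + 0) mod k"
    proof (rule ex1I[of _ "(i, 0)"])
      fix z
      assume "z \<in> J \<and> (fst z + snd z) mod k = (i + 0) mod k"
      then have "fst z = i" "snd z < k" "(i + snd z) mod k = (i + 0) mod k"
        using Ji \<open>a i \<le> k\<close> by auto
      then show "z = (i, 0)"
        using nat_add_mod_inj[of "snd z" k 0 i] i by (auto simp: prod_eq_iff)
    qed (use Ji i in auto)
    then show ?thesis
      by blast
  next
    case 2
    then have ij: "i < k" "j < k" "1 \<le> a i" "1 \<le> a j"
        and Jij: "J = {i} \<times> {..<a i} \<union> {j} \<times> {..<a j}"
      using fst_J[of i] fst_J[of j] J_eq by auto
    have le: "a i \<le> k" "a j \<le> k"
      using a(1) l(1) ij le_trans by blast+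
    have "a i < k \<or> a j < k"
      using l(2)[of i j] a(1) ij 2 le_less_trans by blast
    then consider "a i \<le> a j" "a i < k" | "a j \<le> a i" "a j < k"
      by linarith
    then show ?thesis
    proof cases
      case 1
      then show ?thesis
        using unique_cyclic_color_two_legs[of i k j "a i" "a j"] ij le 2 Jij by simp
    next
      case swap: 2
      then show ?thesis
        using unique_cyclic_color_two_legs[of j k i "a j" "a i"] ij le 2 Jij
        by (simp add: Un_commute)
    qed
  qed
qed

section \<open>Spiders\<close>

text \<open>
  A spider with centre \<open>v\<close> and \<open>k\<close> legs: leg \<open>i\<close> is the path \<open>p i 0 = v, p i 1, \<dots>, p i (l i)\<close>.
\<close>

locale spider = forest_relation E for E :: "('a \<times> 'a) set" +
  fixes A :: "'a set" and v :: 'a and k :: nat and l :: "nat \<Rightarrow> nat" and p :: "nat \<Rightarrow> nat \<Rightarrow> 'a"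
  assumes p_0: "i < k \<Longrightarrow> p i 0 = v"
    and A_eq: "A = {v} \<union> {p i (Suc t) |i t. i < k \<and> t < l i}"
    and p_neq: "i < k \<Longrightarrow> t < l i \<Longrightarrow> p i (Suc t) \<noteq> v"
    and p_inj: "i < k \<Longrightarrow> t < l i \<Longrightarrow> j < k \<Longrightarrow> s < l j \<Longrightarrow> p i (Suc t) = p j (Suc s) \<Longrightarrow> i = j \<and> t = s"
    and p_edge: "i < k \<Longrightarrow> t < l i \<Longrightarrow> (p i t, p i (Suc t)) \<in> E"
    and edge_p: "x \<in> A \<Longrightarrow> y \<in> A \<Longrightarrow> (x, y) \<in> E \<Longrightarrow> \<exists>i<k. \<exists>t<l i. {x, y} = {p i t, p i (Suc t)}"
begin

lemma p_in_A: "i < k \<Longrightarrow> t \<le> l i \<Longrightarrow> p i t \<in> A"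
  unfolding A_eq by (cases t) (use p_0 in \<open>auto dest: Suc_le_lessD\<close>)

lemma p_eq_iff:
  assumes "i < k" "t \<le> l i" "j < k" "s < l j"
  shows "p i t = p j (Suc s) \<longleftrightarrow> i = j \<and> t = Suc s"
proof (cases t)
  case 0
  then show ?thesis
    using assms p_0[of i] p_neq[of j s] by auto
next
  case (Suc r)
  then show ?thesis
    using assms p_inj[of i r j s] by auto
qed

text \<open>By \<open>edge_p\<close> an edge joins consecutive vertices of one leg, and injectivity
  of the labels tells which leg and which depth.\<close>

lemma neighbour_cases:
  assumes "i < k" "t < l i" "x \<in> A" "(p i (Suc t), x) \<in> E"
  shows "x = p i t \<or> Suc t < l i \<and> x = p i (Suc (Suc t))"
proof -
  obtain j s where js: "j < k" "s < l j" "{p i (Suc t), x} = {p j s, p j (Suc s)}"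
    using edge_p[of "p i (Suc t)" x] p_in_A assms by (metis Suc_leI)
  then consider "p i (Suc t) = p j (Suc s)" "x = p j s" | "p j s = p i (Suc t)" "x = p j (Suc s)"
    by (auto simp: doubleton_eq_iff)
  then show ?thesis
  proof cases
    case 1
    then show ?thesis
      using p_inj[of i t j s] assms js by auto
  next
    case 2
    then show ?thesis
      using p_eq_iff[of j s i t] assms js by auto
  qed
qed

lemma not_edge:
  assumes "i < k" "t < l i" "j < k" "s < l j" "i = j \<Longrightarrow> t \<noteq> Suc s \<and> s \<noteq> Suc t"
  shows "(p i (Suc t), p j (Suc s)) \<notin> E"
proof
  assume e: "(p i (Suc t), p j (Suc s)) \<in> E"
  have "p j (Suc s) \<in> A"
    using p_in_A assms by simp
  from neighbour_cases[OF assms(1,2) this e] show False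
  proof
    assume "p j (Suc s) = p i t"
    then show False
      using p_eq_iff[of i t j s] assms by auto
  next
    assume *: "Suc t < l i \<and> p j (Suc s) = p i (Suc (Suc t))"
    then show False
      using p_inj[of j s i "Suc t"] assms by auto
  qed
qed

lemma not_edge_centre:
  assumes "i < k" "Suc t < l i"
  shows "(p i (Suc (Suc t)), v) \<notin> E"
proof
  assume "(p i (Suc (Suc t)), v) \<in> E"
  then show False
    using neighbour_cases[of i "Suc t" v] assms p_in_A[of i 0] p_0[of i] p_neq[of i t]
      p_neq[of i "Suc (Suc t)"] by auto
qed

section \<open>Paths in a spider\<close>

definition leg_edge :: "nat \<times> nat \<Rightarrow> 'a set" where
  "leg_edge z = {p (fst z) (snd z), p (fst z) (Suc (snd z))}"

text \<open>The pairs index the edges, and also the vertices other than the centre: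
  \<open>(i, t)\<close> stands for the edge between depths \<open>t\<close> and \<open>t + 1\<close>
  of leg \<open>i\<close> or for its outer end.\<close>

definition legs :: "(nat \<times> nat) set" where
  "legs = (SIGMA i:{..<k}. {..<l i})"

text \<open>If equal edges had different outer ends, the outer end of each would be the inner end of
  the other, and each would lie deeper than the other.\<close>

lemma inj_leg_edge: "inj_on leg_edge legs"
proof (rule inj_onI)
  fix z z'
  assume z: "z \<in> legs" "z' \<in> legs" "leg_edge z = leg_edge z'"
  obtain i t j s where ij: "z = (i, t)" "z' = (j, s)"
    by (cases z, cases z')
  then have *: "i < k" "t < l i" "j < k" "s < l j"
    using z by (auto simp: legs_def)
  have "{p i t, p i (Suc t)} = {p j s, p j (Suc s)}"
    using z ij by (simp add: leg_edge_def)
  then consider "p i (Suc t) = p j (Suc s)" | "p i t = p j (Suc s)" "p j s = p i (Suc t)"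
    by (auto simp: doubleton_eq_iff)
  then show "z = z'"
  proof cases
    case 1
    then show ?thesis
      using p_inj * ij by blast
  next
    case 2
    then have "t = Suc s" "s = Suc t"
      using p_eq_iff[of i t j s] p_eq_iff[of j s i t] * by auto
    then show ?thesis
      by simp
  qed
qed

lemma edges_on_eq:
  assumes "X \<subseteq> A"
  shows "edges_on X = leg_edge ` {z \<in> legs. leg_edge z \<subseteq> X}"
proof
  show "edges_on X \<subseteq> leg_edge ` {z \<in> legs. leg_edge z \<subseteq> X}"
  proof
    fix e
    assume "e \<in> edges_on X"
    then obtain x y where xy: "e = {x, y}" "x \<in> X" "y \<in> X" "(x, y) \<in> E"
      by (auto simp: edges_on_def)
    then obtain i t where "i < k" "t < l i" "e = {p i t, p i (Suc t)}"
      using edge_p[of x y] assms by auto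
    then have "(i, t) \<in> legs" "e = leg_edge (i, t)" "leg_edge (i, t) \<subseteq> X"
      using xy by (auto simp: legs_def leg_edge_def)
    then show "e \<in> leg_edge ` {z \<in> legs. leg_edge z \<subseteq> X}"
      by blast
  qed
  show "leg_edge ` {z \<in> legs. leg_edge z \<subseteq> X} \<subseteq> edges_on X"
    using p_edge by (auto simp: legs_def leg_edge_def intro!: edges_onI)
qed

text \<open>Without \<open>p i t\<close>, the part of leg \<open>i\<close> beyond it would be closed
  under adjacency in \<open>X\<close>, and \<open>X\<close> would not connect it to
  \<open>v\<close>.\<close>

lemma leg_prefix:
  assumes X: "connected_on X" "X \<subseteq> A" "v \<in> X" and i: "i < k" "t < l i" and pX: "p i (Suc t) \<in> X"
  shows "p i t \<in> X"
proof (rule ccontr)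
  assume nX: "p i t \<notin> X"
  let ?S = "{p i (Suc s) |s. t \<le> s \<and> s < l i}"
  have "v \<in> ?S"
  proof (rule connected_on_closed[OF X(1) pX _ X(3)])
    show "p i (Suc t) \<in> ?S"
      using i by auto
    fix a b
    assume ab: "a \<in> X" "a \<in> ?S" "b \<in> X" "(a, b) \<in> E"
    then obtain s where s: "a = p i (Suc s)" "t \<le> s" "s < l i"
      by auto
    then consider "b = p i s" | "Suc s < l i" "b = p i (Suc (Suc s))"
      using neighbour_cases[of i s b] ab i X(2) by auto
    then show "b \<in> ?S"
    proof cases
      case 1
      then have "s \<noteq> t"
        using nX ab by auto
      then obtain r where "s = Suc r" "t \<le> r"
        using s by (cases s) auto
      then show ?thesis
        using 1 s by auto
    next
      case 2
      then show ?thesis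
        using s by (intro CollectI exI[of _ "Suc s"]) auto
    qed
  qed
  then show False
    using p_neq[OF i(1)] by auto
qed

text \<open>A leg can be left only through the centre.\<close>

lemma leg_of_connected:
  assumes X: "connected_on X" "X \<subseteq> A" "v \<notin> X" and i: "i < k" "t < l i" "p i (Suc t) \<in> X"
    and x: "x \<in> X"
  shows "x \<in> {p i (Suc s) |s. s < l i}"
proof (rule connected_on_closed[OF X(1) i(3) _ x])
  show "p i (Suc t) \<in> {p i (Suc s) |s. s < l i}"
    using i by auto
  fix a b
  assume ab: "a \<in> X" "a \<in> {p i (Suc s) |s. s < l i}" "b \<in> X" "(a, b) \<in> E"
  then obtain s where s: "a = p i (Suc s)" "s < l i"
    by auto
  then consider "b = p i s" | "Suc s < l i" "b = p i (Suc (Suc s))"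
    using neighbour_cases[of i s b] ab i X(2) by auto
  then show "b \<in> {p i (Suc s) |s. s < l i}"
  proof cases
    case 1
    then have "s \<noteq> 0"
      using X(3) ab p_0[OF i(1)] by metis
    then obtain r where "s = Suc r"
      by (cases s) auto
    then show ?thesis
      using 1 s by auto
  next
    case 2
    then show ?thesis
      using s by (intro CollectI exI[of _ "Suc s"]) auto
  qed
qed

text \<open>A path through \<open>v\<close> has at most two neighbours of \<open>v\<close> and so
  uses at most two legs, each in an initial segment. A path that avoids \<open>v\<close> stays in
  one leg, where no color repeats.\<close>

lemma unique_color_on_path:
  assumes X: "path_set X" "X \<subseteq> A"
    and l: "\<And>i. i < k \<Longrightarrow> l i \<le> k" "\<And>i j. i < k \<Longrightarrow> j < k \<Longrightarrow> i \<noteq> j \<Longrightarrow> l i < k \<or> l j < k"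
  shows "\<exists>\<kappa>. \<exists>!z. z \<in> {z \<in> legs. leg_edge z \<subseteq> X} \<and> (fst z + snd z) mod k = \<kappa>"
    (is "\<exists>\<kappa>. \<exists>!z. z \<in> ?J \<and> _")
proof -
  have conn: "connected_on X"
    using X by (simp add: path_set_def)
  have "edges_on X \<noteq> {}"
    using X by (simp add: path_set_def)
  then have "?J \<noteq> {}"
    using edges_on_eq[OF X(2)] by auto
  show ?thesis
  proof (cases "v \<in> X")
    case True
    show ?thesis
    proof (rule unique_cyclic_color)
      show "?J \<subseteq> (SIGMA i:{..<k}. {..<l i})"
        by (auto simp: legs_def)
      show "?J \<noteq> {}"
        by fact
      show down: "(i, t) \<in> ?J" if "(i, Suc t) \<in> ?J" for i t
        using that leg_prefix[OF conn X(2) True, of i t] by (auto simp: legs_def leg_edge_def)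
      have zero: "(i, 0) \<in> ?J" if "(i, t) \<in> ?J" for i t
        using that
      proof (induction t)
        case (Suc t)
        then show ?case
          using down[of i t] by simp
      qed simp
      let ?N = "(\<lambda>i. p i (Suc 0)) ` fst ` ?J"
      have first: "i < k \<and> 0 < l i \<and> p i (Suc 0) \<in> X" if i: "i \<in> fst ` ?J" for i
      proof -
        obtain t where "(i, t) \<in> ?J"
          using i by auto
        then have "(i, 0) \<in> ?J"
          by (rule zero)
        then show ?thesis
          by (auto simp: legs_def leg_edge_def)
      qed
      have "inj_on (\<lambda>i. p i (Suc 0)) (fst ` ?J)"
      proof (rule inj_onI)
        fix i j
        assume "i \<in> fst ` ?J" "j \<in> fst ` ?J" "p i (Suc 0) = p j (Suc 0)"
        then show "i = j"
          using first[of i] first[of j] p_inj[of i 0 j 0] by simp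
      qed
      then have card: "card ?N = card (fst ` ?J)"
        by (rule card_image)
      show "card (fst ` ?J) \<le> 2"
      proof (rule ccontr)
        assume "\<not> card (fst ` ?J) \<le> 2"
        then have "3 \<le> card ?N"
          using card by simp
        then obtain N where N: "N \<subseteq> ?N" "card N = 3"
          by (meson obtain_subset_with_card_n)
        have "(v, n) \<in> E \<and> n \<in> X" if n: "n \<in> N" for n
        proof -
          obtain i where "i \<in> fst ` ?J" "n = p i (Suc 0)"
            using N(1) n by blast
          then show ?thesis
            using first[of i] p_edge[of i 0] p_0[of i] by auto
        qed
        then show False
          using X(1) True N(2) unfolding path_set_def by blast
      qed
    qed (use l in auto)
  next
    case False
    obtain z where z: "z \<in> ?J"
      using \<open>?J \<noteq> {}\<close> by blast
    obtain i t where it: "z = (i, t)" "i < k" "t < l i" "p i (Suc t) \<in> X"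
      using z by (cases z) (auto simp: legs_def leg_edge_def)
    have "\<exists>!z'. z' \<in> ?J \<and> (fst z' + snd z') mod k = (i + t) mod k"
    proof (rule ex1I[of _ z])
      show "z \<in> ?J \<and> (fst z + snd z) mod k = (i + t) mod k"
        using z it by simp
      fix z'
      assume z': "z' \<in> ?J \<and> (fst z' + snd z') mod k = (i + t) mod k"
      obtain j s where js: "z' = (j, s)" "j < k" "s < l j" "p j (Suc s) \<in> X"
        using z' by (cases z') (auto simp: legs_def leg_edge_def)
      obtain r where "r < l i" "p j (Suc s) = p i (Suc r)"
        using leg_of_connected[OF conn X(2) False it(2-4) js(4)] by blast
      then have "j = i"
        using p_inj[of j s i r] js it by blast
      moreover have "s = t"
        using nat_add_mod_inj[of s k t i] z' js it \<open>j = i\<close> l(1)[of i] by simp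
      ultimately show "z' = z"
        using js it by simp
    qed
    then show ?thesis
      by blast
  qed
qed

lemma spider_colorable_if_lengths:
  assumes "0 < k"
    and l: "\<And>i. i < k \<Longrightarrow> l i \<le> k" "\<And>i j. i < k \<Longrightarrow> j < k \<Longrightarrow> i \<noteq> j \<Longrightarrow> l i < k \<or> l j < k"
  shows "colorable A k"
  unfolding colorable_def
proof (intro exI conjI allI impI)
  \<comment> \<open>Inverting \<open>leg_edge\<close> recovers leg and depth of an edge; their sum
    modulo \<open>k\<close> is its color.\<close>
  let ?c = "\<lambda>e. (fst (the_inv_into legs leg_edge e) + snd (the_inv_into legs leg_edge e)) mod k"
  show "?c ` edges_on A \<subseteq> {..<k}"
    using \<open>0 < k\<close> by auto
  fix X
  assume X: "X \<subseteq> A" "path_set X"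
  let ?J = "{z \<in> legs. leg_edge z \<subseteq> X}"
  obtain \<kappa> where "\<exists>!z. z \<in> ?J \<and> (fst z + snd z) mod k = \<kappa>"
    using unique_color_on_path[OF X(2,1) l] by blast
  then obtain z where z: "z \<in> ?J" "(fst z + snd z) mod k = \<kappa>"
      and uniq: "\<And>y. y \<in> ?J \<Longrightarrow> (fst y + snd y) mod k = \<kappa> \<Longrightarrow> y = z"
    by blast
  have c: "?c (leg_edge y) = (fst y + snd y) mod k" if "y \<in> ?J" for y
    using that by (simp add: the_inv_into_f_f[OF inj_leg_edge])
  have "\<exists>!e. e \<in> edges_on X \<and> ?c e = \<kappa>"
  proof (rule ex1I[of _ "leg_edge z"])
    show "leg_edge z \<in> edges_on X \<and> ?c (leg_edge z) = \<kappa>"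
      using z c[OF z(1)] edges_on_eq[OF X(1)] by simp
    fix e
    assume e: "e \<in> edges_on X \<and> ?c e = \<kappa>"
    then obtain y where y: "y \<in> ?J" "e = leg_edge y"
      using edges_on_eq[OF X(1)] by blast
    then show "e = leg_edge z"
      using uniq[of y] c[of y] e by simp
  qed
  then show "conflict_free_on X ?c"
    unfolding conflict_free_on_def by (rule exI)
qed

section \<open>Spiders of small independence number\<close>

definition vertex :: "nat \<times> nat \<Rightarrow> 'a" where
  "vertex z = p (fst z) (Suc (snd z))"

lemma vertex_in_A: "Z \<subseteq> legs \<Longrightarrow> vertex ` Z \<subseteq> A"
  using p_in_A by (fastforce simp: vertex_def legs_def)

lemma card_vertex:
  assumes "Z \<subseteq> legs"
  shows "card (vertex ` Z) = card Z"
proof (rule card_image, rule inj_onI)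
  fix x y
  assume "x \<in> Z" "y \<in> Z" "vertex x = vertex y"
  moreover from this have "x \<in> legs" "y \<in> legs"
    using assms by auto
  ultimately show "x = y"
    using p_inj[of "fst x" "snd x" "fst y" "snd y"] by (auto simp: vertex_def legs_def)
qed

lemma independent_vertex:
  assumes Z: "Z \<subseteq> legs" and "\<And>i t. (i, t) \<in> Z \<Longrightarrow> (i, Suc t) \<notin> Z"
  shows "independent (vertex ` Z)"
proof -
  have "(vertex (i, t), vertex (j, s)) \<notin> E" if "(i, t) \<in> Z" "(j, s) \<in> Z" for i t j s
  proof -
    have "i < k" "t < l i" "j < k" "s < l j"
      using Z that by (auto simp: legs_def)
    moreover have "i = j \<Longrightarrow> t \<noteq> Suc s \<and> s \<noteq> Suc t"
      using assms(2) that by blast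
    ultimately show ?thesis
      using not_edge unfolding vertex_def by simp
  qed
  then show ?thesis
    unfolding independent_def by force
qed

text \<open>With legs of length at most 3, the length conditions of the cyclic coloring can fail
  only for \<open>k \<le> 3\<close>. In each such case an independent set with
  \<open>2 * k - 1\<close> vertices contradicts the bound; for \<open>k = 1\<close> it is
  \<open>{v}\<close>.\<close>

lemma spider_colorable:
  assumes k: "k \<noteq> 0" and alpha: "alpha_le A a" "a + 2 \<le> 2 * k"
    and l: "\<And>i. i < k \<Longrightarrow> 1 \<le> l i" "\<And>i. i < k \<Longrightarrow> l i \<le> 3"
  shows "colorable A k"
proof -
  have card: "card I + 2 \<le> 2 * k" if "I \<subseteq> A" "independent I" for I
    using that alpha le_trans[OF add_le_mono1[of "card I" a 2]] unfolding alpha_le_def by blast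
  have card_Z: "card Z + 2 \<le> 2 * k"
    if "Z \<subseteq> legs" "\<And>i t. (i, t) \<in> Z \<Longrightarrow> (i, Suc t) \<notin> Z" for Z
    using card[OF vertex_in_A independent_vertex] that by (simp add: card_vertex)
  have "{v} \<subseteq> A" "independent {v}"
    using A_eq E_irrefl by (auto simp: independent_def)
  then have k2: "2 \<le> k"
    using card[of "{v}"] by simp
  have three_two: "l i \<noteq> 3" if i: "i < k" "k = 2" for i
  proof
    assume li: "l i = 3"
    \<comment> \<open>With two legs, \<open>1 - i\<close> is the other one.\<close>
    have "1 - i < k" "1 - i \<noteq> i"
      using i by presburger+
    then obtain j where j: "j < k" "j \<noteq> i"
      by blast
    \<comment> \<open>Depths 1 and 3 of leg \<open>i\<close> and depth 1 of the other leg.\<close>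
    then have "{(i, 0), (i, 2), (j, 0)} \<subseteq> legs"
      unfolding legs_def using i li l(1)[of j] by auto
    then show False
      using card_Z[of "{(i, 0), (i, 2), (j, 0)}"] i j by force
  qed
  have two_two: "\<not> (l i = 2 \<and> l j = 2)" if ij: "i < k" "j < k" "i \<noteq> j" "k = 2" for i j
  proof
    assume lij: "l i = 2 \<and> l j = 2"
    \<comment> \<open>The outer ends of both legs; the centre joins them as a third vertex.\<close>
    let ?Z = "{(i, 1), (j, 1)}"
    have Z: "?Z \<subseteq> legs"
      unfolding legs_def using ij lij by auto
    have v: "(x, v) \<notin> E \<and> x \<noteq> v" if "x \<in> vertex ` ?Z" for x
      using that not_edge_centre[of i 0] not_edge_centre[of j 0] p_neq[of i 1] p_neq[of j 1] ij lij
      by (auto simp: vertex_def)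
    have "independent (vertex ` ?Z)"
      using ij by (intro independent_vertex Z) auto
    then have "independent (vertex ` ?Z \<union> {v})"
      using \<open>independent {v}\<close> v by (intro independent_Un) auto
    moreover have "vertex ` ?Z \<union> {v} \<subseteq> A"
      using vertex_in_A[OF Z] \<open>{v} \<subseteq> A\<close> by blast
    moreover have "card (vertex ` ?Z \<union> {v}) = Suc (card (vertex ` ?Z))"
      using v by (subst Un_commute) (auto simp: card_insert_if)
    ultimately show False
      using card[of "vertex ` ?Z \<union> {v}"] card_vertex[OF Z] ij by simp
  qed
  have three_three: "\<not> (l i = 3 \<and> l j = 3)" if ij: "i < k" "j < k" "i \<noteq> j" "k = 3" for i j
  proof
    assume lij: "l i = 3 \<and> l j = 3"
    have "card {i, j} < card {..<k}"
      using ij by simp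
    then have "\<not> {..<k} \<subseteq> {i, j}"
      by (meson card_mono finite.emptyI finite_insert leD)
    then obtain m where m: "m < k" "m \<noteq> i" "m \<noteq> j"
      by blast
    \<comment> \<open>Depths 1 and 3 of the two long legs and depth 1 of the third leg.\<close>
    then have "{(i, 0), (i, 2), (j, 0), (j, 2), (m, 0)} \<subseteq> legs"
      unfolding legs_def using ij lij l(1)[of m] by auto
    then show False
      using card_Z[of "{(i, 0), (i, 2), (j, 0), (j, 2), (m, 0)}"] ij m by force
  qed
  show ?thesis
  proof (rule spider_colorable_if_lengths)
    show "0 < k"
      using k by simp
    show le: "l i \<le> k" if "i < k" for i
      using l(2)[OF that] three_two[OF that] k2 by linarith
    show "l i < k \<or> l j < k" if "i < k" "j < k" "i \<noteq> j" for i j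
      using le[OF that(1)] le[OF that(2)] l(2)[OF that(1)] two_two[OF that] three_three[OF that] k2
      by linarith
  qed
qed

end

section \<open>Vertices of large degree\<close>

context forest_relation
begin

text \<open>Otherwise \<open>vm\<close> would be a second edge between the branch at
  \<open>n\<close> and the rest.\<close>

lemma neighbour_notin_branch:
  assumes A: "connected_on A" "v \<in> A" and n: "n \<in> A" "(v, n) \<in> E" and m: "m \<in> A" "(v, m) \<in> E" "m \<noteq> n"
  shows "m \<notin> branch A n v"
  using cutD(3,4)[OF cut_branch[OF A(1) n(1) A(2) E_sym[OF n(2)]]]
    cutD(8)[OF cut_branch[OF A(1) n(1) A(2) E_sym[OF n(2)]], of m v] m by blast

text \<open>If the branches met, the connected branch at \<open>m\<close> would contain an edge that
  enters the branch at \<open>n\<close>. Such an edge starts at \<open>v\<close>, which is not in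
  the branch at \<open>m\<close>.\<close>

lemma branches_disjoint:
  assumes A: "connected_on A" "v \<in> A" and n: "n \<in> A" "(v, n) \<in> E" and m: "m \<in> A" "(v, m) \<in> E" "m \<noteq> n"
  shows "branch A n v \<inter> branch A m v = {}"
proof (rule ccontr)
  note cut_n = cut_branch[OF A(1) n(1) A(2) E_sym[OF n(2)]]
  note cut_m = cut_branch[OF A(1) m(1) A(2) E_sym[OF m(2)]]
  assume "branch A n v \<inter> branch A m v \<noteq> {}"
  then obtain x where x: "x \<in> branch A n v" "x \<in> branch A m v"
    by blast
  have "connected_on (branch A m v)" "m \<in> branch A m v" "m \<in> A - branch A n v"
    using cutD(3,5)[OF cut_m] neighbour_notin_branch[OF assms] m by blast+
  then obtain a b where ab: "a \<in> branch A m v" "a \<in> A - branch A n v" "b \<in> branch A m v"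
      "b \<notin> A - branch A n v" "(a, b) \<in> E"
    using connected_on_edge[of "branch A m v" m "A - branch A n v" x] x by blast
  then have "b \<in> branch A n v"
    using cutD(1)[OF cut_m] by blast
  then have "a = v"
    using cutD(8)[OF cut_n] ab by blast
  then show False
    using ab cutD(4)[OF cut_m] by blast
qed

text \<open>\<open>v\<close> and the branches at its neighbours are closed under adjacency: a branch
  can be left only to \<open>v\<close>, and each edge at \<open>v\<close> leads into a
  branch.\<close>

lemma branches_cover:
  assumes A: "connected_on A" "v \<in> A" and x: "x \<in> A" "x \<noteq> v"
  obtains n where "n \<in> A" "(v, n) \<in> E" "x \<in> branch A n v"
proof -
  let ?S = "{v} \<union> (\<Union>n\<in>{n \<in> A. (v, n) \<in> E}. branch A n v)"
  have "x \<in> ?S"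
  proof (rule connected_on_closed[OF A(1,2) _ x(1)])
    fix a b
    assume ab: "a \<in> A" "a \<in> ?S" "b \<in> A" "(a, b) \<in> E"
    show "b \<in> ?S"
    proof (cases "a = v")
      case True
      then show ?thesis
        using ab cutD(3)[OF cut_branch[OF A(1) ab(3) A(2)]] E_sym by blast
    next
      case False
      then obtain n where n: "n \<in> A" "(v, n) \<in> E" "a \<in> branch A n v"
        using ab by blast
      then have "b \<in> branch A n v \<or> b = v"
        using cutD(7)[OF cut_branch[OF A(1) n(1) A(2) E_sym[OF n(2)]], of a b] ab by blast
      then show ?thesis
        using n by blast
    qed
  qed auto
  then show thesis
    using x that by blast
qed

text \<open>Indexed as in the \<open>spider\<close> locale: \<open>p 0\<close> is the centre,
  outside \<open>B\<close>. The last conjunct excludes edges other than those of the path.\<close>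

definition leg_of :: "'a \<Rightarrow> 'a set \<Rightarrow> nat \<Rightarrow> (nat \<Rightarrow> 'a) \<Rightarrow> bool" where
  "leg_of v B l p \<longleftrightarrow> 1 \<le> l \<and> l \<le> 3 \<and> p 0 = v \<and> B = (\<lambda>t. p (Suc t)) ` {..<l} \<and> inj_on p {..l} \<and>
     (\<forall>t<l. (p t, p (Suc t)) \<in> E) \<and>
     (\<forall>x\<in>insert v B. \<forall>y\<in>insert v B. (x, y) \<in> E \<longrightarrow> (\<exists>t<l. {x, y} = {p t, p (Suc t)}))"

text \<open>The vertices other than \<open>n\<close> are pairwise adjacent, so without triangles
  there are at most two of them. If there are two, exactly one is adjacent to \<open>n\<close>, and
  the branch is a path.\<close>

lemma branch_is_leg:
  assumes B: "connected_on B" "n \<in> B" "v \<notin> B" "(v, n) \<in> E"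
    and v: "\<And>b. b \<in> B \<Longrightarrow> (v, b) \<in> E \<Longrightarrow> b = n"
    and clique: "\<And>x y. x \<in> B - {n} \<Longrightarrow> y \<in> B - {n} \<Longrightarrow> x \<noteq> y \<Longrightarrow> (x, y) \<in> E"
  shows "\<exists>l p. leg_of v B l p"
proof -
  have v': "b = n" if "b \<in> B" "(b, v) \<in> E" for b
    using v E_sym that by blast
  show ?thesis
  proof (cases "B = {n}")
    case True
    then have "leg_of v B (Suc 0) ((!) [v, n])"
      using B E_irrefl by (auto simp: leg_of_def atMost_Suc lessThan_Suc)
    then show ?thesis
      by blast
  next
    case False
    then obtain a0 where "a0 \<in> B" "a0 \<notin> {n}"
      using B by blast
    then obtain a where a: "a \<in> B" "a \<noteq> n" "(n, a) \<in> E"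
      using connected_on_edge[OF B(1,2), of "{n}" a0] by blast
    then have a': "(a, n) \<in> E" "(v, a) \<notin> E" "(a, v) \<notin> E"
      using v v' E_sym by blast+
    show ?thesis
    proof (cases "B = {n, a}")
      case True
      then have "leg_of v B (Suc (Suc 0)) ((!) [v, n, a])"
        using B E_irrefl a a' by (auto simp: leg_of_def atMost_Suc lessThan_Suc Ex_less_Suc All_less_Suc)
      then show ?thesis
        by blast
    next
      case False
      then obtain b where b: "b \<in> B" "b \<noteq> n" "b \<noteq> a"
        using a B by blast
      have ab: "(a, b) \<in> E"
        using clique[of a b] a b by blast
      have "c = b" if "c \<in> B" "c \<noteq> n" "c \<noteq> a" for c
        using clique[of b c] clique[of a c] no_triangle[OF ab, of c] that a b by blast
      then have B_eq: "B = {n, a, b}"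
        using a b B by blast
      have nb: "(n, b) \<notin> E"
        using no_triangle a ab by blast
      then have b': "(b, n) \<notin> E" "(v, b) \<notin> E" "(b, v) \<notin> E" "(b, a) \<in> E"
        using v v' E_sym b ab by blast+
      have "leg_of v B (Suc (Suc (Suc 0))) ((!) [v, n, a, b])"
        unfolding leg_of_def B_eq using B(3,4) B_eq E_irrefl a(2,3) a' b(2,3) b' nb ab
        by (auto simp: atMost_Suc lessThan_Suc Ex_less_Suc All_less_Suc)
      then show ?thesis
        by blast
    qed
  qed
qed

text \<open>Numbering the neighbours of \<open>v\<close> by \<open>f\<close> turns the branches into
  the legs of a spider.\<close>

lemma colorable_legs:
  assumes A: "finite A" "connected_on A" "v \<in> A" and k: "card {n \<in> A. (v, n) \<in> E} = k" "k \<noteq> 0"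
    and alpha: "alpha_le A a" "a + 2 \<le> 2 * k"
    and legs: "\<And>n. n \<in> A \<Longrightarrow> (v, n) \<in> E \<Longrightarrow> \<exists>l p. leg_of v (branch A n v) l p"
  shows "colorable A k"
proof -
  let ?N = "{n \<in> A. (v, n) \<in> E}"
  obtain f where f: "bij_betw f {0..<k} ?N"
    using ex_bij_betw_nat_finite[of ?N] A k by auto
  obtain l p where lp: "\<And>n. n \<in> A \<Longrightarrow> (v, n) \<in> E \<Longrightarrow> leg_of v (branch A n v) (l n) (p n)"
    using legs by metis
  note cut = cut_branch[OF A(2) _ A(3) E_sym]
  have f_N: "f i \<in> A" "(v, f i) \<in> E" if "i < k" for i
    using bij_betwE[OF f] that by auto
  have f_surj: "\<exists>i<k. n = f i" if "n \<in> A" "(v, n) \<in> E" for n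
  proof -
    have "n \<in> f ` {0..<k}"
      using that bij_betw_imp_surj_on[OF f] by simp
    then show ?thesis
      by auto
  qed
  have leg: "leg_of v (branch A (f i) v) (l (f i)) (p (f i))" if "i < k" for i
    using lp f_N[OF that] by blast
  have p_branch: "p (f i) (Suc t) \<in> branch A (f i) v" if "i < k" "t < l (f i)" for i t
    using leg[OF that(1)] that(2) by (auto simp: leg_of_def)
  interpret spider E A v k "\<lambda>i. l (f i)" "\<lambda>i. p (f i)"
  proof unfold_locales
    show "p (f i) 0 = v" if "i < k" for i
      using leg[OF that] by (simp add: leg_of_def)
    show "A = {v} \<union> {p (f i) (Suc t) |i t. i < k \<and> t < l (f i)}" (is "_ = ?A")
    proof
      show "?A \<subseteq> A"
        using A p_branch cutD(1)[OF cut] f_N by blast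
      show "A \<subseteq> ?A"
      proof
        fix x
        assume x: "x \<in> A"
        show "x \<in> ?A"
        proof (cases "x = v")
          case False
          then obtain n where n: "n \<in> A" "(v, n) \<in> E" "x \<in> branch A n v"
            using branches_cover[OF A(2,3) x] by blast
          then obtain i where i: "i < k" "n = f i"
            using f_surj by blast
          then obtain t where "t < l (f i)" "x = p (f i) (Suc t)"
            using leg[OF i(1)] n by (auto simp: leg_of_def)
          then show ?thesis
            using i by blast
        qed simp
      qed
    qed
    show "p (f i) (Suc t) \<noteq> v" if "i < k" "t < l (f i)" for i t
      using p_branch[OF that] cutD(4)[OF cut] f_N[OF that(1)] by blast
    show "i = j \<and> t = s"
      if "i < k" "t < l (f i)" "j < k" "s < l (f j)" "p (f i) (Suc t) = p (f j) (Suc s)" for i t j s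
    proof -
      have "f i = f j"
        using branches_disjoint[OF A(2,3) f_N[OF that(1)] f_N[OF that(3)]] p_branch that by force
      then have "i = j"
        using f that by (auto simp: bij_betw_def inj_on_def)
      moreover have "inj_on (p (f i)) {..l (f i)}"
        using leg[OF that(1)] by (simp add: leg_of_def)
      ultimately show ?thesis
        using that inj_onD[of "p (f i)" "{..l (f i)}" "Suc t" "Suc s"] by auto
    qed
    show "(p (f i) t, p (f i) (Suc t)) \<in> E" if "i < k" "t < l (f i)" for i t
      using leg[OF that(1)] that(2) by (simp add: leg_of_def)
    show "\<exists>i<k. \<exists>t<l (f i). {x, y} = {p (f i) t, p (f i) (Suc t)}"
      if xy: "x \<in> A" "y \<in> A" "(x, y) \<in> E" for x y
    proof -
      \<comment> \<open>Both ends of an edge lie in a single branch extended by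
        \<open>v\<close>.\<close>
      have "\<exists>n\<in>?N. x \<in> insert v (branch A n v) \<and> y \<in> insert v (branch A n v)"
      proof (cases "x = v")
        case True
        then show ?thesis
          using xy cutD(3)[OF cut[of y]] by blast
      next
        case False
        then obtain n where n: "n \<in> A" "(v, n) \<in> E" "x \<in> branch A n v"
          using branches_cover[OF A(2,3) xy(1)] by blast
        then show ?thesis
          using cutD(7)[OF cut[of n], of x y] xy by blast
      qed
      then obtain i where i: "i < k" "x \<in> insert v (branch A (f i) v)" "y \<in> insert v (branch A (f i) v)"
        using f_surj by blast
      then show ?thesis
        using leg[OF i(1)] xy(3) unfolding leg_of_def by blast
    qed
  qed
  show ?thesis
    using leg by (intro spider_colorable[OF k(2) alpha]) (auto simp: leg_of_def)
qed

text \<open>Only the degree of \<open>v\<close> enters, so the induction can keep \<open>v\<close>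
  and cut off one branch. The inequality survives, as both of its sides drop by 2.\<close>

lemma colorable_degree:
  assumes "finite A" "connected_on A" "v \<in> A" "card {n \<in> A. (v, n) \<in> E} = k"
    and "alpha_le A a" "a + 2 \<le> 2 * k"
  shows "colorable A k"
  using assms
proof (induction k arbitrary: A a)
  case 0
  then show ?case
    by simp
next
  case (Suc k)
  note A = Suc.prems(1-3) and deg = Suc.prems(4) and alpha = Suc.prems(5,6)
  let ?N = "{n \<in> A. (v, n) \<in> E}"
  show ?case
  proof (cases "\<exists>n\<in>?N. \<exists>x\<in>branch A n v - {n}. \<exists>y\<in>branch A n v - {n}. x \<noteq> y \<and> (x, y) \<notin> E")
    case True
    then obtain n x y where n: "n \<in> A" "(v, n) \<in> E" and xy: "x \<in> branch A n v" "y \<in> branch A n v"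
        "x \<noteq> n" "y \<noteq> n" "x \<noteq> y" "(x, y) \<notin> E"
      by blast
    define B where "B = branch A n v"
    define C where "C = A - B"
    have cut: "cut A n v B C"
      unfolding B_def C_def using cut_branch[OF A(2) n(1) A(3) E_sym[OF n(2)]] .
    have fin: "finite B" "finite C"
      using A(1) cutD(1)[OF cut] by auto
    have N_C: "{m \<in> C. (v, m) \<in> E} = ?N - {n}"
      using neighbour_notin_branch[OF A(2,3) n] cutD(3)[OF cut] unfolding B_def C_def by blast
    have card_N: "card (?N - {n}) = k"
      using deg n A(1) by simp
    have "alpha_le B k"
      unfolding alpha_le_def
    proof (intro allI impI)
      fix I
      assume I: "I \<subseteq> B" "independent I"
      \<comment> \<open>The other \<open>k\<close> neighbours of \<open>v\<close> lie in
        \<open>C\<close> and extend \<open>I\<close>, so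
        \<open>card I + k \<le> a \<le> 2 * k\<close>.\<close>
      have "independent (I \<union> (?N - {n}))"
      proof (rule independent_Un[OF I(2)])
        show "independent (?N - {n})"
          using independent_neighbours[of A v] unfolding independent_def by blast
        show "(b, m) \<notin> E" if "b \<in> I" "m \<in> ?N - {n}" for b m
        proof
          assume "(b, m) \<in> E"
          then have "m = v"
            using cutD(7)[OF cut, of b m] that I N_C by blast
          then show False
            using that E_irrefl by blast
        qed
      qed
      moreover have "I \<union> (?N - {n}) \<subseteq> A"
        using I cutD(1)[OF cut] by blast
      moreover have "I \<inter> (?N - {n}) = {}"
        using I N_C cutD(2)[OF cut] by blast
      ultimately have "card I + card (?N - {n}) \<le> a"
        using alpha(1) A(1) I(1) fin(1) finite_subset[of I B]
        unfolding alpha_le_def by (metis (no_types, lifting) card_Un_disjoint finite_Un finite_subset)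
      then show "card I \<le> k"
        using card_N alpha(2) by simp
    qed
    then have "colorable B k"
      using colorable_alpha fin cutD(5)[OF cut] by blast
    have xy_I: "card I + 2 \<le> a" if I: "I \<subseteq> C" "independent I" for I
    proof -
      \<comment> \<open>As \<open>x\<close> and \<open>y\<close> differ from \<open>n\<close>,
        neither has a neighbour in \<open>C\<close>.\<close>
      have "independent ({x, y} \<union> I)"
      proof (rule independent_Un[OF _ I(2)])
        show "independent {x, y}"
          using xy E_irrefl E_sym[of y x] unfolding independent_def by blast
        show "(b, c) \<notin> E" if "b \<in> {x, y}" "c \<in> I" for b c
          using cutD(7)[OF cut, of b c] that I xy unfolding B_def by blast
      qed
      moreover have "{x, y} \<union> I \<subseteq> A"
        using I cutD(1)[OF cut] xy unfolding B_def by blast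
      ultimately have "card ({x, y} \<union> I) \<le> a"
        using alpha(1) unfolding alpha_le_def by blast
      moreover have "{x, y} \<inter> I = {}"
        using I xy unfolding B_def C_def by blast
      ultimately show ?thesis
        using xy finite_subset[OF I(1) fin(2)] by (subst (asm) card_Un_disjoint) auto
    qed
    then have "alpha_le C (a - 2)"
      unfolding alpha_le_def by (metis add_le_imp_le_diff)
    \<comment> \<open>Needed for the truncated subtraction in \<open>a - 2\<close>; the empty set
      gives it.\<close>
    moreover have "2 \<le> a"
      using xy_I[of "{}"] by (simp add: independent_def)
    ultimately have "colorable C k"
      using Suc.IH[of C "a - 2"] fin(2) cutD(4,6)[OF cut] N_C card_N alpha(2) by simp
    with \<open>colorable B k\<close> show ?thesis
      using colorable_cut[OF cut] by blast
  next
    case False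
    show ?thesis
    proof (rule colorable_legs[OF A deg _ alpha])
      fix n
      assume n: "n \<in> A" "(v, n) \<in> E"
      note cut = cut_branch[OF A(2) n(1) A(3) E_sym[OF n(2)]]
      show "\<exists>l p. leg_of v (branch A n v) l p"
      proof (rule branch_is_leg)
        show "b = n" if "b \<in> branch A n v" "(v, b) \<in> E" for b
          using cutD(4)[OF cut] cutD(8)[OF cut, of b v] that by blast
        show "(x, y) \<in> E" if "x \<in> branch A n v - {n}" "y \<in> branch A n v - {n}" "x \<noteq> y" for x y
          using False n that by blast
      qed (use cutD(3-5)[OF cut] n in auto)
    qed simp
  qed
qed

end

section \<open>Trees as digraphs\<close>

locale forest_graph = pair_graph G + F: forest_relation "parcs G" for G :: "'a pair_pre_digraph"
begin

lemma edges_eq: "edges G = F.edges_on (pverts G)"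
proof
  show "edges G \<subseteq> F.edges_on (pverts G)"
    unfolding edges_def ends_def
    by (auto intro!: F.edges_onI dest: arc_fst_in_verts arc_snd_in_verts)
  show "F.edges_on (pverts G) \<subseteq> edges G"
  proof
    fix e
    assume "e \<in> F.edges_on (pverts G)"
    then obtain x y where "e = ends (x, y)" "(x, y) \<in> parcs G"
      by (auto simp: F.edges_on_def ends_def)
    then show "e \<in> edges G"
      unfolding edges_def by blast
  qed
qed

text \<open>The vertices of the path are the sources of its arcs followed by \<open>v\<close>, and
  also \<open>u\<close> followed by the targets. All four claims follow from their
  distinctness.\<close>

lemma apath_inj:
  assumes "apath u p v"
  shows "inj_on fst (set p)" "inj_on snd (set p)" "u \<notin> snd ` set p" "v \<notin> fst ` set p"
proof -
  have dist: "distinct (awalk_verts u p)" and walk: "cas u p v"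
    using assms by (auto simp: apath_def awalk_def)
  have "pawalk_verts u p = map fst p @ [v]"
    using walk by (induction p arbitrary: u) auto
  then show "inj_on fst (set p)" "v \<notin> fst ` set p"
    using dist by (auto simp: distinct_map)
  have "pawalk_verts u p = u # map snd p"
    using walk
  proof (induction p arbitrary: u)
    case (Cons e es)
    then show ?case
      using Cons.IH[of "snd e"] by auto
  qed auto
  then show "inj_on snd (set p)" "u \<notin> snd ` set p"
    using dist by (auto simp: distinct_map)
qed

lemma awalk_rtrancl:
  assumes "awalk u p v" "x \<in> set (awalk_verts u p)"
  shows "(u, x) \<in> (set p)\<^sup>*"
  using assms
proof (induction p arbitrary: u)
  case (Cons e es)
  then have walk: "awalk (snd e) es v" and u: "e = (u, snd e)"
    by (auto simp: awalk_Cons_iff prod_eq_iff)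
  show ?case
  proof (cases "x = u")
    case False
    then have "x \<in> set (awalk_verts (snd e) es)"
      using Cons.prems(2) u by (metis pawalk_verts.simps(2) fst_conv set_ConsD awalk_verts_with_proj_eq)
    then have "(snd e, x) \<in> (set es)\<^sup>*"
      using Cons.IH walk by blast
    then have "(snd e, x) \<in> (set (e # es))\<^sup>*"
      using rtrancl_mono[of "set es" "set (e # es)"] by auto
    moreover have "(u, snd e) \<in> set (e # es)"
      using u by simp
    ultimately show ?thesis
      by (rule converse_rtrancl_into_rtrancl[rotated])
  qed simp
qed auto

text \<open>An edge between two vertices of the path that is not on it would be bypassed by the
  path, although it is a bridge. A vertex has at most one arc of the path in and one out, hence at
  most two neighbours on it.\<close>

lemma apath_is_path_set:
  assumes p: "apath u p v" and "u \<noteq> v"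
  defines "X \<equiv> set (awalk_verts u p)"
  shows "X \<subseteq> pverts G" "F.path_set X" "F.edges_on X = ends ` set p"
proof -
  have walk: "awalk u p v"
    using p by (rule awalkI_apath)
  then show "X \<subseteq> pverts G"
    unfolding X_def by auto
  have p_arcs: "set p \<subseteq> parcs G"
    using walk by auto
  have p_X: "fst e \<in> X \<and> snd e \<in> X" if "e \<in> set p" for e
    using awalk_verts_arc1[OF that] awalk_verts_arc2[OF walk that] unfolding X_def by simp
  have reach: "(u, x) \<in> (set p)\<^sup>*" if "x \<in> X" for x
    using awalk_rtrancl[OF walk] that unfolding X_def by blast
  \<comment> \<open>\<open>R\<close> is used twice: as the arcs inside \<open>X\<close>, and as all
    arcs but one edge.\<close>
  have reach_sym: "(x, y) \<in> R\<^sup>*" if "x \<in> X" "y \<in> X" "set p \<subseteq> R" "sym R" for x y R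
  proof -
    have "(u, x) \<in> R\<^sup>*" "(u, y) \<in> R\<^sup>*"
      using reach[OF that(1)] reach[OF that(2)] rtrancl_mono[OF that(3)] by auto
    then show ?thesis
      using symD[OF sym_rtrancl[OF that(4)]] rtrancl_trans by metis
  qed
  have conn: "F.connected_on X"
    unfolding F.connected_on_def
  proof (intro ballI)
    fix x y
    assume "x \<in> X" "y \<in> X"
    then show "(x, y) \<in> (Restr (parcs G) X)\<^sup>*"
      by (rule reach_sym) (use p_arcs p_X in \<open>auto intro: symI F.E_sym\<close>)
  qed
  show edges: "F.edges_on X = ends ` set p"
  proof
    show "ends ` set p \<subseteq> F.edges_on X"
      using p_arcs p_X by (auto simp: ends_def intro!: F.edges_onI)
    show "F.edges_on X \<subseteq> ends ` set p"
    proof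
      fix e
      assume "e \<in> F.edges_on X"
      then obtain x y where xy: "e = {x, y}" "x \<in> X" "y \<in> X" "(x, y) \<in> parcs G"
        by (auto simp: F.edges_on_def)
      have "(x, y) \<in> set p \<or> (y, x) \<in> set p"
      proof (rule ccontr)
        assume "\<not> ?thesis"
        then have "set p \<subseteq> parcs G - {(x, y), (y, x)}"
          using p_arcs by auto
        then have "(x, y) \<in> (parcs G - {(x, y), (y, x)})\<^sup>*"
          by (rule reach_sym[OF xy(2,3)]) (auto intro: symI F.E_sym)
        then show False
          using F.bridge[OF xy(4)] by contradiction
      qed
      then show "e \<in> ends ` set p"
        using xy(1) by (force simp: ends_def)
    qed
  qed
  have "p \<noteq> []"
    using walk \<open>u \<noteq> v\<close> by (auto simp: awalk_Nil_iff)
  then have "F.edges_on X \<noteq> {}"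
    using edges by simp
  moreover have False if w: "w \<in> X" and N: "N \<subseteq> X" "card N = 3" "\<forall>n\<in>N. (w, n) \<in> parcs G" for w N
  proof -
    let ?O = "{n. (w, n) \<in> set p}" and ?I = "{n. (n, w) \<in> set p}"
    have "N \<subseteq> ?O \<union> ?I"
    proof
      fix n
      assume "n \<in> N"
      then have "{w, n} \<in> ends ` set p"
        using w N edges F.edges_onI[of w X n] by blast
      then show "n \<in> ?O \<union> ?I"
        by (auto simp: ends_def doubleton_eq_iff)
    qed
    have O: "x = y" if "x \<in> ?O" "y \<in> ?O" for x y
      using inj_onD[OF apath_inj(1)[OF p], of "(w, x)" "(w, y)"] that by simp
    have I: "x = y" if "x \<in> ?I" "y \<in> ?I" for x y
      using inj_onD[OF apath_inj(2)[OF p], of "(x, w)" "(y, w)"] that by simp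
    obtain x y z where xyz: "x \<in> N" "y \<in> N" "z \<in> N" "x \<noteq> y" "y \<noteq> z" "x \<noteq> z"
      using N(2) by (auto simp: card_3_iff)
    then have "x \<in> ?O \<or> x \<in> ?I" "y \<in> ?O \<or> y \<in> ?I" "z \<in> ?O \<or> z \<in> ?I"
      using \<open>N \<subseteq> ?O \<union> ?I\<close> by blast+
    then show False
      using O[of x y] O[of y z] O[of x z] I[of x y] I[of y z] I[of x z] xyz by argo
  qed
  ultimately show "F.path_set X"
    unfolding F.path_set_def using conn by blast
qed

lemma conflict_free_connected_if:
  assumes conn: "\<And>u v. u \<in> pverts G \<Longrightarrow> v \<in> pverts G \<Longrightarrow> \<exists>p. apath u p v"
    and c: "\<And>X. X \<subseteq> pverts G \<Longrightarrow> F.path_set X \<Longrightarrow> F.conflict_free_on X c"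
  shows "conflict_free_connected G c"
  unfolding conflict_free_connected_def
proof (intro ballI impI)
  fix u v
  assume uv: "u \<in> pverts G" "v \<in> pverts G" "u \<noteq> v"
  obtain p where p: "apath u p v"
    using conn uv by blast
  note X = apath_is_path_set[OF p uv(3)]
  have "conflict_free_path c p"
    using c[OF X(1,2)] X(3) by (simp add: F.conflict_free_on_def conflict_free_path_def)
  with p show "\<exists>p. apath u p v \<and> conflict_free_path c p"
    by blast
qed

text \<open>\<open>v\<close> is on the path, since otherwise the path and \<open>vm\<close> would
  bypass the bridge \<open>vn\<close>. Then both edges are on the path, and its ends leave room for
  nothing else.\<close>

lemma apath_between_neighbours:
  assumes n: "(v, n) \<in> parcs G" and m: "(v, m) \<in> parcs G" and "n \<noteq> m" and p: "apath n p m"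
  shows "p = [(n, v), (v, m)]"
proof -
  let ?X = "set (awalk_verts n p)"
  note X = apath_is_path_set[OF p \<open>n \<noteq> m\<close>]
  have nm: "n \<in> ?X" "m \<in> ?X"
    using awalkI_apath[OF p] hd_in_awalk_verts(2)[OF p]
    by (auto elim!: awalkE' intro: last_in_set)
  have v_X: "v \<in> ?X"
  proof (rule ccontr)
    assume "v \<notin> ?X"
    let ?R = "parcs G - {(v, n), (n, v)}"
    have "(m, n) \<in> (Restr (parcs G) ?X)\<^sup>*"
      using X(2) nm by (auto simp: F.path_set_def F.connected_on_def)
    moreover have "Restr (parcs G) ?X \<subseteq> ?R"
      using \<open>v \<notin> ?X\<close> by auto
    ultimately have "(m, n) \<in> ?R\<^sup>*"
      using rtrancl_mono by blast
    moreover have "(v, m) \<in> ?R"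
      using m \<open>n \<noteq> m\<close> F.E_irrefl by auto
    ultimately have "(v, n) \<in> ?R\<^sup>*"
      by (rule converse_rtrancl_into_rtrancl[rotated])
    then show False
      using F.bridge[OF n] by contradiction
  qed
  have "{v, n} \<in> ends ` set p" "{v, m} \<in> ends ` set p"
    using F.edges_onI[OF v_X nm(1) n] F.edges_onI[OF v_X nm(2) m] X(3) by auto
  then have "(v, n) \<in> set p \<or> (n, v) \<in> set p" "(v, m) \<in> set p \<or> (m, v) \<in> set p"
    by (auto simp: ends_def doubleton_eq_iff)
  \<comment> \<open>A path neither returns to its start \<open>n\<close> nor leaves its end
    \<open>m\<close>; this fixes both directions.\<close>
  then have nv: "(n, v) \<in> set p" and vm: "(v, m) \<in> set p"
    using apath_inj(3,4)[OF p] by force+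
  obtain x q where q: "p = (n, x) # q"
    using nv p by (cases p) (auto simp: apath_Cons_iff)
  then have "x = v"
    using inj_onD[OF apath_inj(1)[OF p], of "(n, v)" "(n, x)"] nv by simp
  then have "apath v q m" "(v, m) \<in> set q"
    using p q vm n F.E_irrefl by (auto simp: apath_Cons_iff)
  then obtain y r where r: "q = (v, y) # r"
    by (cases q) (auto simp: apath_Cons_iff)
  then have "y = m"
    using inj_onD[OF apath_inj(1)[OF \<open>apath v q m\<close>], of "(v, m)" "(v, y)"] \<open>(v, m) \<in> set q\<close> by simp
  then have "r = []"
    using \<open>apath v q m\<close> r apath_nonempty_ends[of m r m] by (auto simp: apath_Cons_iff)
  then show ?thesis
    using q r \<open>x = v\<close> \<open>y = m\<close> by simp
qed

lemma out_degree_eq: "out_degree (with_proj G) v = card {n \<in> pverts G. (v, n) \<in> parcs G}"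
proof -
  have "out_arcs (with_proj G) v = Pair v ` {n \<in> pverts G. (v, n) \<in> parcs G}"
    using in_arcsD2 by (auto simp: out_arcs_def)
  then show ?thesis
    by (simp add: out_degree_def card_image inj_on_def)
qed

text \<open>If \<open>vn\<close> and \<open>vm\<close> had the same color, the only path from
  \<open>n\<close> to \<open>m\<close> would consist of two edges of that color.\<close>

lemma out_degree_le_colors:
  assumes c: "conflict_free_connected G c"
  shows "out_degree (with_proj G) v \<le> card (c ` edges G)"
proof -
  let ?N = "{n \<in> pverts G. (v, n) \<in> parcs G}"
  have "inj_on (\<lambda>n. c {v, n}) ?N"
  proof (rule inj_onI, rule ccontr)
    fix n m
    assume nm: "n \<in> ?N" "m \<in> ?N" "c {v, n} = c {v, m}" "n \<noteq> m"
    then obtain p where p: "apath n p m" "conflict_free_path c p"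
      using c unfolding conflict_free_connected_def by blast
    then have set_p: "ends ` set p = {{v, n}, {v, m}}"
      using apath_between_neighbours[of v n m p] nm by (auto simp: ends_def)
    have "{v, n} \<noteq> {v, m}"
      using nm by (auto simp: doubleton_eq_iff)
    obtain k where "\<exists>!e. e \<in> ends ` set p \<and> c e = k"
      using p(2) unfolding conflict_free_path_def ..
    then obtain e where e: "e \<in> ends ` set p" "c e = k"
        "\<And>e'. e' \<in> ends ` set p \<Longrightarrow> c e' = k \<Longrightarrow> e' = e"
      by (elim ex1E) blast
    from e(1) set_p have "c {v, n} = k" "c {v, m} = k"
      using e(2) nm(3) by auto
    then have "{v, n} = e" "{v, m} = e"
      by (intro e(3); simp add: set_p)+
    then show False
      using \<open>{v, n} \<noteq> {v, m}\<close> by simp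
  qed
  then have "card ?N = card ((\<lambda>n. c {v, n}) ` ?N)"
    by (simp add: card_image)
  also have "\<dots> \<le> card (c ` edges G)"
  proof (rule card_mono)
    show "finite (c ` edges G)"
      using pair_finite_arcs by (simp add: edges_def)
    show "(\<lambda>n. c {v, n}) ` ?N \<subseteq> c ` edges G"
      by (force simp: edges_def ends_def)
  qed
  finally show ?thesis
    by (simp add: out_degree_eq)
qed

lemma alpha_le_independence_number: "F.alpha_le (pverts G) (independence_number G)"
  unfolding F.alpha_le_def independence_number_def
proof (intro allI impI)
  fix I
  assume "I \<subseteq> pverts G" "F.independent I"
  then have "independent_set G I"
    by (auto simp: independent_set_def F.independent_def pairwise_def)
  moreover have "finite {S. independent_set G S}"
    by (rule finite_subset[of _ "Pow (pverts G)"]) (use pair_finite_verts in \<open>auto simp: independent_set_def\<close>)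
  ultimately show "card I \<le> Max (card ` {S. independent_set G S})"
    by (intro Max_ge) auto
qed

end

text \<open>A walk from \<open>u\<close> to \<open>w\<close> that avoids the edge \<open>uw\<close>
  shortens to a path with at least two arcs. The arc \<open>(w, u)\<close> closes it to a cycle of
  length at least 3.\<close>

lemma forest_graph_if_undirected_tree:
  assumes "undirected_tree G"
  shows "forest_graph G"
proof -
  interpret pair_graph G
    using assms by (simp add: undirected_tree_def)
  have acyclic: "\<not> (cycle p \<and> 3 \<le> length p)" for p
    using assms by (auto simp: undirected_tree_def)
  show ?thesis
  proof unfold_locales
    show "(y, x) \<in> parcs G" if "(x, y) \<in> parcs G" for x y
      using arcs_symmetric[OF that] .
    show "(u, w) \<notin> (parcs G - {(u, w), (w, u)})\<^sup>*" if uw: "(u, w) \<in> parcs G" for u w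
    proof
      assume "(u, w) \<in> (parcs G - {(u, w), (w, u)})\<^sup>*"
      moreover define R where "R = parcs G - {(u, w), (w, u)}"
      ultimately have "(u, w) \<in> R\<^sup>*"
        by simp
      have R: "R \<subseteq> parcs G" "(u, w) \<notin> R"
        by (auto simp: R_def)
      have "\<exists>p. awalk u p w \<and> set p \<subseteq> R"
        using \<open>(u, w) \<in> R\<^sup>*\<close>
      proof (induction rule: converse_rtrancl_induct)
        case base
        then show ?case
          using uw in_arcsD2 by (intro exI[of _ "[]"]) (simp add: awalk_Nil_iff)
      next
        case (step x y)
        then obtain p where "awalk y p w" "set p \<subseteq> R"
          by blast
        then show ?case
          using step.hyps R(1) by (intro exI[of _ "(x, y) # p"]) (auto simp: awalk_Cons_iff)
      qed
      then obtain p where p: "awalk u p w" "set p \<subseteq> R"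
        by blast
      define q where "q = awalk_to_apath p"
      have q: "apath u q w" "set q \<subseteq> R"
        unfolding q_def using apath_awalk_to_apath[OF p(1)] awalk_to_apath_subset[OF p(1)] p(2) by auto
      have "u \<noteq> w"
        using uw no_loops' by blast
      then have "q \<noteq> []"
        using q(1) by (auto simp: apath_Nil_iff)
      moreover have "q \<noteq> [e]" for e
        using q R(2) by (cases e) (auto simp: apath_Cons_iff apath_Nil_iff)
      ultimately have "3 \<le> length ((w, u) # q)"
        by (cases q; cases "tl q") auto
      moreover have "awalk w ((w, u) # q) w"
        using q(1) uw arcs_symmetric by (auto simp: awalk_Cons_iff apath_def)
      then have "cycle ((w, u) # q)"
        unfolding cycle_def using q(1) by (intro exI[of _ w]) (simp add: apath_def)
      ultimately show False
        using acyclic by blast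
    qed
  qed
qed

theorem theorem2:
  fixes T :: "'a pair_pre_digraph"
  assumes "undirected_tree T"
    and "real (max_degree T) \<ge> (real (independence_number T) + 2) / 2"
  shows "cfc T = max_degree T"
proof -
  interpret forest_graph T
    using assms(1) by (rule forest_graph_if_undirected_tree)
  have strong: "strongly_connected (mk_symmetric T)"
    using assms(1) by (simp add: undirected_tree_def Digraph_Component.connected_def)
  then have ne: "pverts T \<noteq> {}"
    by (simp add: strongly_connected_def)
  \<comment> \<open>The arcs are already symmetric, so reachability in the symmetric closure is
    reachability in \<open>T\<close>.\<close>
  have conn: "\<exists>p. apath u p v" if "u \<in> pverts T" "v \<in> pverts T" for u v
    using strong that reachable_mk_symmetric_eq[OF pair_sym_arcs] reachable_apath
    unfolding strongly_connected_def by auto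
  have "max_degree T \<in> out_degree (with_proj T) ` pverts T"
    unfolding max_degree_def using ne pair_finite_verts by (intro Max_in) auto
  then obtain v where v: "v \<in> pverts T" "max_degree T = out_degree (with_proj T) v"
    by blast
  have "F.connected_on (pverts T)"
    unfolding F.connected_on_def
  proof (intro ballI)
    fix x y
    assume "x \<in> pverts T" "y \<in> pverts T"
    then obtain p where p: "awalk x p y"
      using conn awalkI_apath by blast
    then have "(x, y) \<in> (set p)\<^sup>*"
      using awalk_rtrancl[OF p, of y] by (auto elim!: awalkE' intro: last_in_set)
    moreover have "set p \<subseteq> Restr (parcs T) (pverts T)"
      using p unfolding awalk_def by (auto dest: in_arcsD1 in_arcsD2)
    ultimately show "(x, y) \<in> (Restr (parcs T) (pverts T))\<^sup>*"
      using rtrancl_mono by blast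
  qed
  moreover have "independence_number T + 2 \<le> 2 * max_degree T"
  proof -
    have "real (independence_number T + 2) \<le> real (2 * max_degree T)"
      using assms(2) by simp
    then show ?thesis
      by (simp only: of_nat_le_iff)
  qed
  ultimately have "F.colorable (pverts T) (max_degree T)"
    using F.colorable_degree[OF pair_finite_verts _ v(1) _ alpha_le_independence_number]
      v(2) out_degree_eq by simp
  then obtain c where c: "c ` edges T \<subseteq> {..<max_degree T}"
      "\<And>X. X \<subseteq> pverts T \<Longrightarrow> F.path_set X \<Longrightarrow> F.conflict_free_on X c"
    unfolding F.colorable_def edges_eq by blast
  have cfc: "conflict_free_connected T c"
    using conflict_free_connected_if conn c(2) by blast
  \<comment> \<open>The coloring is only known to use at most this many colors; the degree of
    \<open>v\<close> forces equality.\<close>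
  have "card (c ` edges T) = max_degree T"
  proof (rule antisym)
    show "card (c ` edges T) \<le> max_degree T"
      using card_mono[OF _ c(1)] by simp
    show "max_degree T \<le> card (c ` edges T)"
      using out_degree_le_colors[OF cfc] v(2) by simp
  qed
  then show ?thesis
    unfolding cfc_def using cfc out_degree_le_colors v(2) by (intro Least_equality) auto
qed

end
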